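(* Let $A,B$ be $\mathbb{N}_0$-valued random variables such that $0<\mu:=E(A)<1$. Let $\alpha\in(1,2)$ and let $L$ be a slowly varying function such that $P(A>x)=x^{-\alpha}L(x)$. Assume that $$\lim_{x\to\infty}\frac{P(B>x)}{P(A>x)}=c$$ for some finite constant $c\ge 0$, and, if $c>0$, assume also that $B$ is consistently varying. Let $X_t$ and $X'_t$ be random variables with $X_t\stackrel{d}{=}\sum_{k=0}^\infty C_{t,k}$ and $X'_t\stackrel{d}{=}\sup_{k\ge 0}C_{t,k}$. Then $$\lim_{x\to\infty}\frac{P(X_t>x)}{P(A>x)}=\lim_{x\to\infty}\frac{P(X'_t>x)}{P(A>x)}=\sum_{k=0}^\infty\psi_k,$$ where $\psi_k=E(B)\,d_k+c\,\mu^{k\alpha}$ and $d_k=\mu^{(k-1)\alpha}\sum_{j=0}^{k-1}\mu^{j(1-\alpha)}$ for $k\ge 0$ (so that $d_0=0$, the empty sum being $0$).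
   Context: $\mathbb{N}_0=\{0,1,2,\dots\}$. A nonnegative random variable $B$ is consistently varying if $\lim_{\lambda\downarrow1}\liminf_{x\to\infty}P(B>\lambda x)/P(B>x)=1$. A random mapping $\theta$ with offspring variable $A$ is defined by $\theta\circ x=\theta(x)=\sum_{i=1}^x A_i$ for $x\in\mathbb{N}_0$, where $(A_i)$ are i.i.d. copies of $A$. Let $(B_t)_{t\in\mathbb{Z}}$ be i.i.d. copies of $B$, and let $(\theta^{(s)}_t)_{s,t\in\mathbb{Z}}$ be independent random mappings with offspring variable $A$, independent of $(B_t)$. Put $C_{t,0}=B_t$ and, for $k\ge1$, $C_{t,k}=\theta^{(t-k)}_t\circ\theta^{(t-k)}_{t-1}\circ\cdots\circ\theta^{(t-k)}_{t-k+1}(B_{t-k})$. For fixed $t$ the variables $(C_{t,k})_{k\ge0}$ are independent, and $C_{t,k}$ is distributed as the sum of $B_{t-k}$ independent copies (independent of $B_{t-k}$) of the size of the $k$-th generation of a Galton–Watson process with offspring law that of $A$ started from one individual. The law of $\sum_{k\ge 0} C_{t,k}$ is the unique stationary distribution of the branching process with immigration $X_t=\sum_{i=1}^{X_{t-1}}A^{(t)}_i+B_t$, where $(A_i^{(t)})_{i,t}$ are i.i.d. copies of $A$ independent of $(B_t)$. *)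

theory Defs
  imports "HOL-Probability.Probability"
begin

definition slowly_varying :: "(real \<Rightarrow> real) \<Rightarrow> bool" where
  "slowly_varying L \<longleftrightarrow>
     (\<exists>x0>0. L \<in> borel_measurable (restrict_space borel {x0..}) \<and> (\<forall>x\<ge>x0. L x > 0)) \<and>
     (\<forall>l>0. ((\<lambda>x. L (l * x) / L x) \<longlongrightarrow> 1) at_top)"

text \<open>The inner limit inferior is taken in \<^typ>\<open>ereal\<close>, a complete lattice. If the tail of
  \<open>Y\<close> vanishes eventually, the quotient is \<open>0 / 0 = 0\<close>, so a bounded \<open>Y\<close> is
  not consistently varying.\<close>

definition consistently_varying :: "'a measure \<Rightarrow> ('a \<Rightarrow> real) \<Rightarrow> bool" where
  "consistently_varying M Y \<longleftrightarrow>
     ((\<lambda>l. Liminf at_top (\<lambda>x::real.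
          ereal (\<P>(\<omega> in M. Y \<omega> > l * x) / \<P>(\<omega> in M. Y \<omega> > x)))) \<longlongrightarrow> 1) (at_right 1)"

text \<open>The copies of the offspring variable used by a random mapping are numbered from 0:
  the \<open>x\<close> summands are \<open>a 0, \<dots>, a (x - 1)\<close>.\<close>

definition random_mapping :: "(nat \<Rightarrow> 'a \<Rightarrow> nat) \<Rightarrow> 'a \<Rightarrow> nat \<Rightarrow> nat" where
  "random_mapping a \<omega> x = (\<Sum>i<x. a i \<omega>)"

text \<open>\<open>iterate_mappings \<theta> s k\<close> is \<open>\<theta> (s + k) \<circ> \<dots> \<circ> \<theta> (s + 1)\<close>.\<close>

primrec iterate_mappings :: "(int \<Rightarrow> 'b \<Rightarrow> 'b) \<Rightarrow> int \<Rightarrow> nat \<Rightarrow> 'b \<Rightarrow> 'b" where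
  "iterate_mappings \<theta> s 0 = id"
| "iterate_mappings \<theta> s (Suc k) = \<theta> (s + int (Suc k)) \<circ> iterate_mappings \<theta> s k"

text \<open>\<open>As s u i\<close> is the \<open>i\<close>-th offspring copy of the mapping with superscript \<open>s\<close> and
  subscript \<open>u\<close>. In \<open>C\<^sub>t\<^sub>,\<^sub>k\<close> all mappings have superscript \<open>t - k\<close>,
  and their subscripts run from \<open>t - k + 1\<close> (innermost) to \<open>t\<close> (outermost).\<close>

definition cluster ::
    "(int \<Rightarrow> 'a \<Rightarrow> nat) \<Rightarrow> (int \<Rightarrow> int \<Rightarrow> nat \<Rightarrow> 'a \<Rightarrow> nat) \<Rightarrow> int \<Rightarrow> nat \<Rightarrow> 'a \<Rightarrow> nat" where
  "cluster Bs As t k \<omega> =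
     iterate_mappings (\<lambda>u. random_mapping (As (t - int k) u) \<omega>) (t - int k) k
       (Bs (t - int k) \<omega>)"

definition d_coeff :: "real \<Rightarrow> real \<Rightarrow> nat \<Rightarrow> real" where
  "d_coeff \<mu> \<alpha> k = \<mu> powr ((real k - 1) * \<alpha>) * (\<Sum>j<k. \<mu> powr (real j * (1 - \<alpha>)))"

definition psi_coeff :: "real \<Rightarrow> real \<Rightarrow> real \<Rightarrow> real \<Rightarrow> nat \<Rightarrow> real" where
  "psi_coeff EB c \<mu> \<alpha> k = EB * d_coeff \<mu> \<alpha> k + c * \<mu> powr (real k * \<alpha>)"

end

theory Submission
  imports Defs
begin

text \<open>Write \<open>g x = P(A > x)\<close>, which is regularly varying with index \<open>-\<alpha>\<close>, and let \<open>C\<^sub>k\<close> be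
  \<open>C\<^sub>t\<^sub>,\<^sub>k\<close>. In law, \<open>C\<^sub>0\<close> is \<open>B\<close> and \<open>C\<^sub>k\<^sub>+\<^sub>1\<close> is a sum of \<open>C\<^sub>k\<close> independent copies of \<open>A\<close>.
  The proof has three ingredients.

  One random sum (\<open>compound_tail\<close>). If \<open>N\<close> is independent of the copies \<open>A\<^sub>i\<close>, with partial
  sums \<open>S\<^sub>n\<close>, and \<open>P(N > x) / g x \<rightarrow> c\<close>, then
  \<open>P(S\<^sub>N > x) / g x \<rightarrow> E(N) + c \<mu>\<^sup>\<alpha>\<close>. A large value of \<open>S\<^sub>N\<close> comes either from one large
  \<open>A\<^sub>i\<close>, which costs \<open>E(N) g x\<close>, or from \<open>N > x / \<mu>\<close>, because \<open>S\<^sub>N\<close> is close to \<open>\<mu> N\<close> when \<open>N\<close> is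
  large. The middle range, where \<open>N\<close> is large but below \<open>(1 - \<epsilon>) x / \<mu>\<close>, is negligible by the
  deviation bound \<open>P(\<bar>S\<^sub>n - n\<mu>\<bar> \<ge> y) \<le> K n g y\<close>, valid for all \<open>n\<close> and all large \<open>y\<close>.
  Iterating gives \<open>P(C\<^sub>k > x) / g x \<rightarrow> \<psi>\<^sub>k\<close>, since \<open>\<psi>\<^sub>k\<^sub>+\<^sub>1 = E(B) \<mu>\<^sup>k + \<mu>\<^sup>\<alpha> \<psi>\<^sub>k\<close>.

  Uniformity in \<open>k\<close> (\<open>generation_huber_bound\<close>). The deviation bound and the bound on all
  generations come from a single convex function, the Huber function \<open>h\<close>, which is quadratic near
  \<open>0\<close> and linear far out. It satisfies \<open>h(a + b) \<le> h(a) + h'(a) b + 2 h(b)\<close>, so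
  centred independent summands enter only through \<open>E h\<close>, without truncation: conditioning on \<open>N\<close>
  gives \<open>E h(S\<^sub>N / x) \<le> E h(\<mu> N / x) + 2 E(N) E h((A - \<mu>) / x)\<close>. For \<open>1 < \<alpha> < 2\<close> a Karamata
  argument along powers of two bounds \<open>E h(A / x)\<close> by a multiple of \<open>g x\<close>. Since
  \<open>g(x / \<mu>) \<le> \<mu> g x\<close> for large \<open>x\<close>, iteration yields \<open>E h(C\<^sub>k / x) \<le> K \<rho>\<^sup>k g x\<close> for every
  \<open>k\<close>, all large \<open>x\<close> and any \<open>\<rho> > \<mu>\<close>.

  Summation over \<open>k\<close> (\<open>sum_and_sup_tail\<close>). For independent summands the tails add up,
  for finite sums as well as for finite maxima. The contribution
  of \<open>k \<ge> n\<close> to the sum is at most a multiple of \<open>w\<^sup>3\<^sup>n g x\<close> by a union bound, where \<open>w < 1\<close> and \<open>w\<^sup>3 > \<mu>\<close>: if these terms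
  sum to more than \<open>x\<close>, one of them exceeds its share \<open>(1 - w) w\<^sup>k\<^sup>-\<^sup>n x\<close>. As the supremum is below
  the sum, an upper bound for the sum and a lower bound for finite maxima determine both limits.\<close>

section \<open>The Huber function\<close>

definition clip :: "real \<Rightarrow> real" where
  "clip y = max (-1) (min 1 y)"

text \<open>The function is \<open>y\<^sup>2\<close> on \<open>[-1, 1]\<close> and \<open>2\<bar>y\<bar> - 1\<close> outside, with derivative \<open>2 clip y\<close>. The form
  chosen here exhibits it as the maximum of \<open>2 s y - s\<^sup>2\<close> over \<open>\<bar>s\<bar> \<le> 1\<close>, attained at \<open>s = clip y\<close>, and
  spares the case distinctions.\<close>

definition huber :: "real \<Rightarrow> real" where
  "huber y = 2 * clip y * y - (clip y)\<^sup>2"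

lemma huber_ge: "2 * s * y - s\<^sup>2 \<le> huber y" if "\<bar>s\<bar> \<le> 1"
proof -
  have "(s - clip y) * (2 * y - s - clip y) \<le> 0"
  proof (cases "\<bar>y\<bar> \<le> 1")
    case True
    then have "clip y = y" by (auto simp: clip_def)
    moreover have "(s - y) * (2 * y - s - y) = - ((s - y)\<^sup>2)"
      by (simp add: power2_eq_square algebra_simps)
    ultimately show ?thesis by simp
  next
    case False
    then consider "y > 1" "clip y = 1" | "y < -1" "clip y = -1" by (fastforce simp: clip_def)
    then show ?thesis
      using that by cases (auto simp: mult_nonpos_nonneg mult_nonneg_nonpos)
  qed
  then show ?thesis by (simp add: huber_def power2_eq_square algebra_simps)
qed

lemma huber_nonneg [simp]: "0 \<le> huber y"
  using huber_ge[of 0 y] by simp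

lemma huber_0 [simp]: "huber 0 = 0"
  by (simp add: huber_def clip_def)

lemma huber_le_square: "huber y \<le> y\<^sup>2"
proof -
  have "0 \<le> (y - clip y)\<^sup>2" by simp
  then show ?thesis by (simp add: huber_def power2_eq_square algebra_simps)
qed

lemma huber_le_linear: "huber y \<le> 2 * \<bar>y\<bar>"
proof -
  have "clip y * y \<le> \<bar>clip y\<bar> * \<bar>y\<bar>" by (metis abs_ge_self abs_mult)
  also have "\<dots> \<le> \<bar>y\<bar>" by (rule mult_left_le_one_le) (auto simp: clip_def)
  finally have "clip y * y \<le> \<bar>y\<bar>" .
  moreover have "0 \<le> (clip y)\<^sup>2" by simp
  ultimately show ?thesis unfolding huber_def by linarith
qed

lemma norm_huber_le: "norm (huber y) \<le> norm (2 * y)"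
  using huber_le_linear[of y] by (simp add: abs_mult)

text \<open>First-order Taylor bound with a remainder of the same shape as the function. The increment
  \<open>\<delta>\<close> of \<open>clip\<close> has modulus at most 2, so \<open>\<delta> / 2\<close> is an admissible slope in the variational
  description of \<open>huber b\<close>. The linear term vanishes in expectation when \<open>b\<close> is a centred variable
  independent of \<open>a\<close>, which is the purpose of the inequality.\<close>

lemma huber_add: "huber (a + b) \<le> huber a + 2 * clip a * b + 2 * huber b"
proof -
  define \<delta> where "\<delta> = clip (a + b) - clip a"
  have "\<bar>\<delta> / 2\<bar> \<le> 1" by (auto simp: \<delta>_def clip_def)
  from huber_ge[OF this, of b] have 1: "2 * \<delta> * b - \<delta>\<^sup>2 / 2 \<le> 2 * huber b"
    by (simp add: power_divide)
  \<comment> \<open>A nonzero \<open>a - clip a\<close> means that \<open>clip\<close> is extremal at \<open>a\<close>, so that \<open>clip\<close> can only move inwards.\<close>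
  have "\<delta> * (a - clip a) \<le> 0"
    by (auto simp: \<delta>_def clip_def max_def min_def mult_le_0_iff)
  moreover have "huber (a + b) = huber a + 2 * clip a * b + 2 * (\<delta> * (a - clip a)) + 2 * \<delta> * b - \<delta>\<^sup>2"
    by (simp add: huber_def \<delta>_def power2_eq_square algebra_simps)
  moreover have "\<delta>\<^sup>2 \<ge> 0" by simp
  ultimately show ?thesis using 1 by linarith
qed

lemma huber_ge_level: "q\<^sup>2 \<le> huber y" if "0 \<le> q" "q \<le> 1" "q \<le> y"
proof -
  have "q * q \<le> q * y" using that by (simp add: mult_left_mono)
  then show ?thesis using huber_ge[of q y] that by (simp add: power2_eq_square)
qed

lemma huber_minus [simp]: "huber (- y) = huber y"
  by (auto simp: huber_def clip_def max_def min_def)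

section \<open>Tails of integer-valued laws and truncated moments\<close>

definition tail :: "nat pmf \<Rightarrow> real \<Rightarrow> real" where
  "tail p x = measure_pmf.prob p {n. x < real n}"

lemma tail_nonneg [simp]: "0 \<le> tail p x"
  and tail_le_1 [simp]: "tail p x \<le> 1"
  by (auto simp: tail_def)

lemma tail_antimono: "x \<le> y \<Longrightarrow> tail p y \<le> tail p x"
  unfolding tail_def by (rule measure_pmf.finite_measure_mono) auto

lemma tail_tendsto_0: "(tail p \<longlongrightarrow> 0) at_top"
proof -
  have "((\<lambda>x. \<integral>n. indicator {n. x < real n} n \<partial>measure_pmf p) \<longlongrightarrow> (\<integral>n. (0::real) \<partial>measure_pmf p)) at_top"
  proof (rule integral_dominated_convergence_at_top[where w = "\<lambda>_. 1 :: real"])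
    show "AE n in p. ((\<lambda>x. indicator {n. x < real n} n) \<longlongrightarrow> (0::real)) at_top"
    proof (rule AE_I2)
      fix n :: nat
      have "eventually (\<lambda>x. indicator {n. x < real n} n = (0::real)) at_top"
        using eventually_ge_at_top[of "real n"] by eventually_elim auto
      then show "((\<lambda>x. indicator {n. x < real n} n) \<longlongrightarrow> (0::real)) at_top"
        by (rule tendsto_eventually)
    qed
  qed (auto simp: indicator_def)
  then show ?thesis by (simp add: tail_def[abs_def])
qed

lemma nn_integral_pmf_indicator: "(\<integral>\<^sup>+n. indicator {n. x < real n} n \<partial>measure_pmf p) = ennreal (tail p x)"
  by (simp add: tail_def measure_pmf.emeasure_eq_measure)

definition truncated_moment :: "nat pmf \<Rightarrow> real \<Rightarrow> real" where
  "truncated_moment p x = (\<integral>n. (min (real n) x)\<^sup>2 \<partial>measure_pmf p)"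

lemma truncated_moment_integrable:
  "0 \<le> x \<Longrightarrow> integrable (measure_pmf p) (\<lambda>n. (min (real n) x)\<^sup>2)"
  by (rule measure_pmf.integrable_const_bound[where B = "x\<^sup>2"]) (auto intro!: power_mono)

lemma truncated_moment_le: "0 \<le> x \<Longrightarrow> truncated_moment p x \<le> x\<^sup>2"
  unfolding truncated_moment_def
  by (rule measure_pmf.integral_le_const[OF truncated_moment_integrable])
     (auto intro!: power_mono)

text \<open>Between the truncation levels \<open>x\<close> and \<open>2 x\<close> the square grows by at most \<open>4 x\<^sup>2 - x\<^sup>2\<close>, and only on
  \<open>{n. x < n}\<close>.\<close>

lemma truncated_moment_double:
  assumes "0 \<le> x"
  shows "truncated_moment p (2 * x) \<le> truncated_moment p x + 3 * x\<^sup>2 * tail p x"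
proof -
  have int: "integrable (measure_pmf p) (\<lambda>n. 3 * x\<^sup>2 * indicator {n. x < real n} n)"
    by (intro integrable_mult_right) (simp add: measure_pmf.emeasure_eq_measure)
  have "truncated_moment p (2 * x)
      \<le> (\<integral>n. (min (real n) x)\<^sup>2 + 3 * x\<^sup>2 * indicator {n. x < real n} n \<partial>measure_pmf p)"
    unfolding truncated_moment_def
  proof (rule integral_mono)
    fix n
    show "(min (real n) (2 * x))\<^sup>2 \<le> (min (real n) x)\<^sup>2 + 3 * x\<^sup>2 * indicator {n. x < real n} n"
    proof (cases "x < real n")
      case True
      have "(min (real n) (2 * x))\<^sup>2 \<le> (2 * x)\<^sup>2" by (rule power_mono) (use assms in auto)
      then show ?thesis using True by (simp add: power2_eq_square)
    next
      case False
      then show ?thesis using assms by simp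
    qed
  qed (use assms int in \<open>auto intro!: truncated_moment_integrable Bochner_Integration.integrable_add\<close>)
  also have "\<dots> = truncated_moment p x + 3 * x\<^sup>2 * tail p x"
    using assms int unfolding truncated_moment_def
    by (subst Bochner_Integration.integral_add)
       (auto intro!: truncated_moment_integrable simp: tail_def)
  finally show ?thesis .
qed

lemma dyadic_cover:
  fixes y x :: real
  assumes "0 < x"
  shows "ennreal y * indicator {x<..} y \<le> (\<Sum>j. ennreal (2 ^ Suc j * x) * indicator {2 ^ j * x<..} y)"
proof (cases "x < y")
  case True
  define k where "k = (LEAST k. y \<le> 2 ^ k * x)"
  obtain m :: nat where "y / x < 2 ^ m" using real_arch_pow[of 2 "y / x"] by auto
  then have "y \<le> 2 ^ m * x" using assms by (simp add: field_simps)
  then have k: "y \<le> 2 ^ k * x" unfolding k_def by (rule LeastI)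
  have "k \<noteq> 0" using k True by (cases k) auto
  then obtain j where j: "k = Suc j" by (cases k) auto
  then have "\<not> y \<le> 2 ^ j * x" using not_less_Least[of j "\<lambda>k. y \<le> 2 ^ k * x"] by (auto simp: k_def)
  then have "ennreal y * indicator {x<..} y \<le> ennreal (2 ^ Suc j * x) * indicator {2 ^ j * x<..} y"
    using k j True by (auto intro!: ennreal_leI)
  also have "\<dots> = (\<Sum>j\<in>{j}. ennreal (2 ^ Suc j * x) * indicator {2 ^ j * x<..} y)"
    by (simp only: sum.insert sum.empty finite.emptyI empty_iff not_False_eq_True add_0_right)
  also have "\<dots> \<le> (\<Sum>j. ennreal (2 ^ Suc j * x) * indicator {2 ^ j * x<..} y)"
    by (rule sum_le_suminf) auto
  finally show ?thesis .
qed auto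

section \<open>Moment bounds of Karamata type\<close>

locale heavy_tailed_offspring =
  fixes a :: "nat pmf" and \<mu> \<alpha> :: real
  assumes mean: "(\<integral>\<^sup>+n. ennreal (real n) \<partial>measure_pmf a) = ennreal \<mu>"
    and mean_pos: "0 < \<mu>" and index_gt_1: "1 < \<alpha>" and index_lt_2: "\<alpha> < 2"
    and tail_pos: "\<And>x. 0 < tail a x"
    and tail_ratio: "\<And>l. 0 < l \<Longrightarrow> ((\<lambda>x. tail a (l * x) / tail a x) \<longlongrightarrow> l powr (-\<alpha>)) at_top"
begin

text \<open>The index \<open>\<alpha> > 1\<close> makes \<open>2 g(2 x) / g x\<close> eventually smaller than a constant below 1, so that dyadic
  sums of first moments converge.\<close>

lemma tail_double_le:
  obtains \<theta> x0 where "0 < \<theta>" "2 * \<theta> < 1" "0 < x0" "\<And>x. x0 \<le> x \<Longrightarrow> tail a (2 * x) \<le> \<theta> * tail a x"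
proof -
  have "2 powr (-\<alpha>) < 2 powr (-1)" using index_gt_1 by (intro powr_less_mono) auto
  then obtain \<theta> where th: "2 powr (-\<alpha>) < \<theta>" "\<theta> < 2 powr (-1)" using dense by blast
  have "eventually (\<lambda>x. tail a (2 * x) / tail a x < \<theta>) at_top"
    using order_tendstoD(2)[OF tail_ratio[of 2] th(1)] by simp
  then obtain x0 where x0: "\<And>x. x0 \<le> x \<Longrightarrow> tail a (2 * x) / tail a x < \<theta>"
    by (auto simp: eventually_at_top_linorder)
  show thesis
  proof (rule that[of \<theta> "max 1 x0"])
    show "0 < \<theta>" using th(1) by (smt (verit) powr_ge_zero)
    show "2 * \<theta> < 1" using th(2) by (simp add: powr_minus)
    show "tail a (2 * x) \<le> \<theta> * tail a x" if "max 1 x0 \<le> x" for x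
      using x0[of x] that tail_pos[of x] by (simp add: field_simps)
  qed auto
qed

text \<open>The index \<open>\<alpha> < 2\<close> makes \<open>4 g(2 x) / g x\<close> eventually larger than a constant above 1, so that dyadic
  sums of second moments are dominated by their last term.\<close>

lemma tail_double_ge:
  obtains \<theta> x0 where "1 < 4 * \<theta>" "0 < x0" "\<And>x. x0 \<le> x \<Longrightarrow> \<theta> * tail a x \<le> tail a (2 * x)"
proof -
  have "2 powr (-2) < 2 powr (-\<alpha>)" using index_lt_2 by (intro powr_less_mono) auto
  then obtain \<theta> where th: "2 powr (-2) < \<theta>" "\<theta> < 2 powr (-\<alpha>)" using dense by blast
  have "eventually (\<lambda>x. \<theta> < tail a (2 * x) / tail a x) at_top"
    using order_tendstoD(1)[OF tail_ratio[of 2] th(2)] by simp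
  then obtain x0 where x0: "\<And>x. x0 \<le> x \<Longrightarrow> \<theta> < tail a (2 * x) / tail a x"
    by (auto simp: eventually_at_top_linorder)
  show thesis
  proof (rule that[of \<theta> "max 1 x0"])
    have "2 powr (-2) = (1/4 :: real)" by (simp add: powr_minus)
    then show "1 < 4 * \<theta>" using th(1) by simp
    show "\<theta> * tail a x \<le> tail a (2 * x)" if "max 1 x0 \<le> x" for x
      using x0[of x] that tail_pos[of x] by (simp add: field_simps)
  qed auto
qed

definition dominated :: "nat pmf \<Rightarrow> bool" where
  "dominated p \<longleftrightarrow> (\<exists>C. eventually (\<lambda>x. tail p x \<le> C * tail a x) at_top)"

lemma dominatedE:
  assumes "dominated p"
  obtains C x0 where "0 < C" "0 < x0" "\<And>x. x0 \<le> x \<Longrightarrow> tail p x \<le> C * tail a x"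
proof -
  obtain C x0 where C: "\<And>x. x0 \<le> x \<Longrightarrow> tail p x \<le> C * tail a x"
    using assms by (auto simp: dominated_def eventually_at_top_linorder)
  have "tail p x \<le> max 1 C * tail a x" if "max 1 x0 \<le> x" for x
    using C[of x] that mult_right_mono[of C "max 1 C" "tail a x"] by auto
  then show thesis by (intro that[of "max 1 C" "max 1 x0"]) auto
qed

text \<open>Induction along \<open>x, 2 x, 4 x, \<dots>\<close>: one doubling step turns the constant \<open>K\<close> into
  \<open>(K + 3 C) / (4 \<theta>)\<close>, and since \<open>4 \<theta> > 1\<close> a large enough \<open>K\<close> is preserved.\<close>

lemma truncated_moment_bound:
  assumes "dominated p"
  obtains K x0 where "0 < K" "0 < x0"
    "\<And>x. x0 \<le> x \<Longrightarrow> truncated_moment p x \<le> K * x\<^sup>2 * tail a x"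
proof -
  obtain C x1 where C: "0 < C" "0 < x1" "\<And>x. x1 \<le> x \<Longrightarrow> tail p x \<le> C * tail a x"
    by (rule dominatedE[OF assms]) blast
  obtain \<theta> x2 where \<theta>: "1 < 4 * \<theta>" "0 < x2" "\<And>x. x2 \<le> x \<Longrightarrow> \<theta> * tail a x \<le> tail a (2 * x)"
    by (rule tail_double_ge) blast
  define x0 where "x0 = max x1 x2"
  have x0: "0 < x0" using C by (auto simp: x0_def)
  \<comment> \<open>The first entry covers the base interval from \<open>x0\<close> to \<open>2 x0\<close>, the second the doubling step.\<close>
  define K where "K = max (1 / tail a (2 * x0)) (3 * C / (4 * \<theta> - 1))"
  have K: "0 < K" using tail_pos[of "2 * x0"] by (simp add: K_def less_max_iff_disj)
  have "3 * C / (4 * \<theta> - 1) \<le> K" by (simp add: K_def)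
  then have "3 * C \<le> K * (4 * \<theta> - 1)" using \<theta>(1) by (simp add: field_simps)
  then have K3: "K + 3 * C \<le> 4 * \<theta> * K" by (simp add: algebra_simps)
  have claim: "truncated_moment p x \<le> K * x\<^sup>2 * tail a x" if "x0 \<le> x" "x \<le> 2 ^ j * x0" for x j
    using that
  proof (induction j arbitrary: x)
    case (Suc j)
    show ?case
    proof (cases "x \<le> 2 * x0")
      case True
      have "1 \<le> K * tail a (2 * x0)"
        using tail_pos[of "2 * x0"] unfolding K_def
        by (metis divide_le_eq max.cobounded1)
      also have "\<dots> \<le> K * tail a x" using True K by (intro mult_left_mono tail_antimono) auto
      finally have "x\<^sup>2 * 1 \<le> x\<^sup>2 * (K * tail a x)" by (rule mult_left_mono) simp
      moreover have "truncated_moment p x \<le> x\<^sup>2" using Suc.prems x0 by (intro truncated_moment_le) auto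
      ultimately show ?thesis by (simp add: algebra_simps)
    next
      case False
      define y where "y = x / 2"
      have y: "x = 2 * y" "x0 \<le> y" "y \<le> 2 ^ j * x0" using Suc.prems False by (auto simp: y_def)
      have "truncated_moment p x \<le> truncated_moment p y + 3 * y\<^sup>2 * tail p y"
        using truncated_moment_double[of y p] y x0 by auto
      also have "\<dots> \<le> K * y\<^sup>2 * tail a y + 3 * y\<^sup>2 * (C * tail a y)"
        using C(3)[of y] y by (intro add_mono Suc.IH mult_left_mono) (auto simp: x0_def)
      also have "\<dots> = y\<^sup>2 * tail a y * (K + 3 * C)" by (simp add: algebra_simps)
      also have "\<dots> \<le> y\<^sup>2 * tail a y * (4 * \<theta> * K)" using K3 by (intro mult_left_mono) auto
      also have "\<dots> = (4 * K * y\<^sup>2) * (\<theta> * tail a y)" by (simp add: algebra_simps)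
      also have "\<dots> \<le> (4 * K * y\<^sup>2) * tail a x"
        using \<theta>(3)[of y] y K by (intro mult_left_mono) (auto simp: x0_def)
      finally show ?thesis by (simp add: y(1) power2_eq_square algebra_simps)
    qed
  next
    case 0
    have "1 \<le> K * tail a (2 * x0)"
      using tail_pos[of "2 * x0"] unfolding K_def by (metis divide_le_eq max.cobounded1)
    also have "\<dots> \<le> K * tail a x" using 0 K x0 by (intro mult_left_mono tail_antimono) auto
    finally have "x\<^sup>2 * 1 \<le> x\<^sup>2 * (K * tail a x)" by (rule mult_left_mono) simp
    moreover have "truncated_moment p x \<le> x\<^sup>2" using 0 x0 by (intro truncated_moment_le) auto
    ultimately show ?case by (simp add: algebra_simps)
  qed
  show thesis
  proof (rule that[OF K x0])
    fix x assume "x0 \<le> x"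
    obtain j :: nat where "x / x0 < 2 ^ j" using real_arch_pow[of 2 "x / x0"] by auto
    then have "x \<le> 2 ^ j * x0" using x0 by (simp add: field_simps)
    with \<open>x0 \<le> x\<close> show "truncated_moment p x \<le> K * x\<^sup>2 * tail a x" by (rule claim)
  qed
qed

text \<open>The mass between \<open>2\<^sup>j x\<close> and \<open>2\<^sup>j\<^sup>+\<^sup>1 x\<close> contributes at most \<open>2\<^sup>j\<^sup>+\<^sup>1 x P(Y > 2\<^sup>j x)\<close>, where
  \<open>Y\<close> has law \<open>p\<close>; these terms are dominated by a geometric series with ratio \<open>2 \<theta> < 1\<close>. Working with
  nonnegative integrals avoids presupposing a finite mean, which is a consequence.\<close>

lemma excess_mean_bound:
  assumes "dominated p"
  obtains K x0 where "0 < K" "0 < x0"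
    "\<And>x. x0 \<le> x \<Longrightarrow> (\<integral>\<^sup>+n. ennreal (real n) * indicator {x<..} (real n) \<partial>measure_pmf p)
        \<le> ennreal (K * x * tail a x)"
proof -
  obtain C x1 where C: "0 < C" "0 < x1" "\<And>x. x1 \<le> x \<Longrightarrow> tail p x \<le> C * tail a x"
    by (rule dominatedE[OF assms]) blast
  obtain \<theta> x2 where \<theta>: "0 < \<theta>" "2 * \<theta> < 1" "0 < x2" "\<And>x. x2 \<le> x \<Longrightarrow> tail a (2 * x) \<le> \<theta> * tail a x"
    by (rule tail_double_le) blast
  show thesis
  proof (rule that[of "2 * C / (1 - 2 * \<theta>)" "max x1 x2"])
    fix x assume x: "max x1 x2 \<le> x"
    then have x0: "0 < x" using C(2) by auto
    have ge: "max x1 x2 \<le> 2 ^ j * x" for j :: nat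
    proof -
      have "1 * x \<le> 2 ^ j * x" using x0 by (intro mult_right_mono) auto
      with x show ?thesis by linarith
    qed
    have step: "tail a (2 ^ j * x) \<le> \<theta> ^ j * tail a x" for j
    proof (induction j)
      case (Suc j)
      have "tail a (2 ^ Suc j * x) \<le> \<theta> * tail a (2 ^ j * x)"
        using \<theta>(4)[of "2 ^ j * x"] ge[of j] by (simp add: algebra_simps)
      also have "\<dots> \<le> \<theta> * (\<theta> ^ j * tail a x)" using Suc \<theta>(1) by (intro mult_left_mono) auto
      finally show ?case by (simp add: algebra_simps)
    qed simp
    have "(\<integral>\<^sup>+n. ennreal (real n) * indicator {x<..} (real n) \<partial>measure_pmf p)
       \<le> (\<integral>\<^sup>+n. (\<Sum>j. ennreal (2 ^ Suc j * x) * indicator {2 ^ j * x<..} (real n)) \<partial>measure_pmf p)"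
      by (intro nn_integral_mono dyadic_cover x0)
    also have "\<dots> = (\<Sum>j. \<integral>\<^sup>+n. ennreal (2 ^ Suc j * x) * indicator {2 ^ j * x<..} (real n) \<partial>measure_pmf p)"
      by (rule nn_integral_suminf) auto
    also have "\<dots> = (\<Sum>j. ennreal (2 ^ Suc j * x * tail p (2 ^ j * x)))"
    proof (rule suminf_cong)
      fix j :: nat
      have "(\<integral>\<^sup>+n. ennreal (2 ^ Suc j * x) * indicator {2 ^ j * x<..} (real n) \<partial>measure_pmf p)
          = (\<integral>\<^sup>+n. ennreal (2 ^ Suc j * x) * indicator {n. 2 ^ j * x < real n} n \<partial>measure_pmf p)"
        by (intro nn_integral_cong) (auto simp: indicator_def)
      also have "\<dots> = ennreal (2 ^ Suc j * x) * ennreal (tail p (2 ^ j * x))"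
        by (subst nn_integral_cmult) (auto simp: nn_integral_pmf_indicator)
      finally show "(\<integral>\<^sup>+n. ennreal (2 ^ Suc j * x) * indicator {2 ^ j * x<..} (real n) \<partial>measure_pmf p)
          = ennreal (2 ^ Suc j * x * tail p (2 ^ j * x))"
        using x0 by (simp add: ennreal_mult)
    qed
    also have "\<dots> \<le> (\<Sum>j. ennreal (2 * C * x * tail a x * (2 * \<theta>) ^ j))"
    proof (intro suminf_le ennreal_leI)
      fix j :: nat
      have "tail p (2 ^ j * x) \<le> C * tail a (2 ^ j * x)" using C(3) ge[of j] by auto
      also have "\<dots> \<le> C * (\<theta> ^ j * tail a x)" using C(1) step by (intro mult_left_mono) auto
      finally have "2 ^ Suc j * x * tail p (2 ^ j * x) \<le> 2 ^ Suc j * x * (C * (\<theta> ^ j * tail a x))"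
        using x0 by (intro mult_left_mono) auto
      then show "2 ^ Suc j * x * tail p (2 ^ j * x) \<le> 2 * C * x * tail a x * (2 * \<theta>) ^ j"
        by (simp add: algebra_simps power_mult_distrib)
    qed auto
    also have "\<dots> = ennreal (2 * C * x * tail a x * (1 / (1 - 2 * \<theta>)))"
    proof (intro suminf_ennreal_eq sums_mult geometric_sums)
      show "0 \<le> 2 * C * x * tail a x * (2 * \<theta>) ^ j" for j
        using C \<theta> x0 by auto
    qed (use \<theta> in auto)
    finally show "(\<integral>\<^sup>+n. ennreal (real n) * indicator {x<..} (real n) \<partial>measure_pmf p)
        \<le> ennreal (2 * C / (1 - 2 * \<theta>) * x * tail a x)" by simp
  qed (use C \<theta> in auto)
qed

lemma dominated_finite_mean:
  assumes "dominated p"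
  shows "(\<integral>\<^sup>+n. ennreal (real n) \<partial>measure_pmf p) < \<infinity>"
proof -
  obtain K x where K: "0 < K" "0 < x" and
    le: "\<And>y. x \<le> y \<Longrightarrow> (\<integral>\<^sup>+n. ennreal (real n) * indicator {y<..} (real n) \<partial>measure_pmf p) \<le> ennreal (K * y * tail a y)"
    by (rule excess_mean_bound[OF assms]) blast
  have "(\<integral>\<^sup>+n. ennreal (real n) \<partial>measure_pmf p)
      \<le> (\<integral>\<^sup>+n. ennreal x + ennreal (real n) * indicator {x<..} (real n) \<partial>measure_pmf p)"
    by (intro nn_integral_mono) (auto simp: indicator_def intro!: ennreal_leI)
  also have "\<dots> = ennreal x + (\<integral>\<^sup>+n. ennreal (real n) * indicator {x<..} (real n) \<partial>measure_pmf p)"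
    by (subst nn_integral_add) auto
  also have "\<dots> \<le> ennreal x + ennreal (K * x * tail a x)" using le by (intro add_left_mono) auto
  also have "\<dots> < \<infinity>" by simp
  finally show ?thesis .
qed

text \<open>The Huber function is bounded by its quadratic part below the level \<open>x\<close> and by its linear part above,
  so the two preceding bounds apply.\<close>

lemma huber_moment_bound:
  assumes "dominated p"
  obtains K x0 where "0 < K" "0 < x0"
    "\<And>x. x0 \<le> x \<Longrightarrow> (\<integral>\<^sup>+n. ennreal (huber (real n / x)) \<partial>measure_pmf p) \<le> ennreal (K * tail a x)"
proof -
  obtain K1 x1 where 1: "0 < K1" "0 < x1"
    "\<And>x. x1 \<le> x \<Longrightarrow> truncated_moment p x \<le> K1 * x\<^sup>2 * tail a x"
    by (rule truncated_moment_bound[OF assms]) blast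
  obtain K2 x2 where 2: "0 < K2" "0 < x2"
    "\<And>x. x2 \<le> x \<Longrightarrow> (\<integral>\<^sup>+n. ennreal (real n) * indicator {x<..} (real n) \<partial>measure_pmf p) \<le> ennreal (K2 * x * tail a x)"
    by (rule excess_mean_bound[OF assms]) blast
  show thesis
  proof (rule that[of "K1 + 2 * K2" "max x1 x2"])
    fix x assume x: "max x1 x2 \<le> x"
    then have x0: "0 < x" using 1 by auto
    have "ennreal (huber (real n / x)) \<le> ennreal (inverse (x\<^sup>2)) * ennreal ((min (real n) x)\<^sup>2)
        + ennreal (2 / x) * (ennreal (real n) * indicator {x<..} (real n))" for n
    proof (cases "x < real n")
      case True
      then have "ennreal (huber (real n / x)) \<le> ennreal (2 / x) * ennreal (real n)"
        using huber_le_linear[of "real n / x"] x0 by (simp flip: ennreal_mult add: ennreal_leI)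
      with True show ?thesis by (simp add: add_increasing)
    next
      case False
      have "huber (real n / x) \<le> inverse (x\<^sup>2) * (real n)\<^sup>2"
        using huber_le_square[of "real n / x"] by (simp add: power_divide divide_inverse power_mult_distrib power_inverse mult.commute)
      with False show ?thesis by (simp flip: ennreal_mult add: ennreal_leI)
    qed
    then have "(\<integral>\<^sup>+n. ennreal (huber (real n / x)) \<partial>measure_pmf p)
        \<le> (\<integral>\<^sup>+n. ennreal (inverse (x\<^sup>2)) * ennreal ((min (real n) x)\<^sup>2)
        + ennreal (2 / x) * (ennreal (real n) * indicator {x<..} (real n)) \<partial>measure_pmf p)"
      by (intro nn_integral_mono)
    also have "\<dots> = ennreal (inverse (x\<^sup>2)) * ennreal (truncated_moment p x)
        + ennreal (2 / x) * (\<integral>\<^sup>+n. ennreal (real n) * indicator {x<..} (real n) \<partial>measure_pmf p)"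
      using x0 by (subst nn_integral_add)
        (auto simp: nn_integral_cmult truncated_moment_def truncated_moment_integrable nn_integral_eq_integral)
    also have "\<dots> \<le> ennreal (inverse (x\<^sup>2)) * ennreal (K1 * x\<^sup>2 * tail a x) + ennreal (2 / x) * ennreal (K2 * x * tail a x)"
      using x 1 2 by (intro add_mono mult_left_mono ennreal_leI) auto
    also have "\<dots> = ennreal ((K1 + 2 * K2) * tail a x)"
      using x0 1 2 by (simp flip: ennreal_mult ennreal_plus) (simp add: field_simps power2_eq_square)
    finally show "(\<integral>\<^sup>+n. ennreal (huber (real n / x)) \<partial>measure_pmf p) \<le> ennreal ((K1 + 2 * K2) * tail a x)" .
  qed (use 1 2 in auto)
qed

lemma dominated_offspring: "dominated a"
  unfolding dominated_def by (rule exI[of _ 1]) simp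

text \<open>Replacing \<open>A\<close> by \<open>A - \<mu>\<close> costs an error of order \<open>x\<^sup>-\<^sup>2\<close>. It is absorbed because the truncated second
  moment of \<open>A\<close> is bounded away from 0 while being at most a multiple of \<open>x\<^sup>2 g x\<close>.\<close>

lemma inverse_square_le_tail:
  obtains K x0 where "0 < K" "0 < x0" "\<And>x. x0 \<le> x \<Longrightarrow> 1 / x\<^sup>2 \<le> K * tail a x"
proof -
  obtain K1 x1 where 1: "0 < K1" "0 < x1"
    "\<And>x. x1 \<le> x \<Longrightarrow> truncated_moment a x \<le> K1 * x\<^sup>2 * tail a x"
    by (rule truncated_moment_bound[OF dominated_offspring]) blast
  show thesis
  proof (rule that[of "K1 / tail a 0" "max 1 x1"])
    fix x assume x: "max 1 x1 \<le> x"
    have "tail a 0 = (\<integral>n. indicator {n. 0 < real n} n \<partial>measure_pmf a)" by (simp add: tail_def)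
    also have "\<dots> \<le> truncated_moment a x"
      unfolding truncated_moment_def
    proof (rule integral_mono)
      show "integrable (measure_pmf a) (indicator {n. 0 < real n} :: nat \<Rightarrow> real)"
        by (simp add: measure_pmf.emeasure_eq_measure)
      show "indicator {n. 0 < real n} n \<le> (min (real n) x)\<^sup>2" for n
        using x by (cases n) (auto simp: indicator_def intro!: one_le_power)
    qed (use x in \<open>auto intro!: truncated_moment_integrable\<close>)
    also have "\<dots> \<le> K1 * x\<^sup>2 * tail a x" using x 1 by auto
    finally show "1 / x\<^sup>2 \<le> K1 / tail a 0 * tail a x"
      using x tail_pos[of 0] by (simp add: field_simps)
  qed (use 1 tail_pos[of 0] in auto)
qed

end

section \<open>Random sums of independent copies\<close>

primrec iid_sum :: "nat pmf \<Rightarrow> nat \<Rightarrow> nat pmf" where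
  "iid_sum p 0 = return_pmf 0"
| "iid_sum p (Suc n) = map_pmf (\<lambda>(s, y). s + y) (pair_pmf (iid_sum p n) p)"

lemma nn_integral_iid_sum_Suc:
  "(\<integral>\<^sup>+s. f s \<partial>measure_pmf (iid_sum p (Suc n)))
    = (\<integral>\<^sup>+s. \<integral>\<^sup>+y. f (s + y) \<partial>measure_pmf p \<partial>measure_pmf (iid_sum p n))"
  by (simp add: nn_integral_pair_pmf' case_prod_beta)

definition compound :: "nat pmf \<Rightarrow> nat pmf \<Rightarrow> nat pmf" where
  "compound a p = bind_pmf p (iid_sum a)"

lemma nn_integral_compound:
  "(\<integral>\<^sup>+s. f s \<partial>measure_pmf (compound a p)) = (\<integral>\<^sup>+n. \<integral>\<^sup>+s. f s \<partial>measure_pmf (iid_sum a n) \<partial>measure_pmf p)"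
  by (simp add: compound_def)

lemma tail_compound:
  "tail (compound a p) x = (\<integral>n. tail (iid_sum a n) x \<partial>measure_pmf p)"
proof -
  have "ennreal (tail (compound a p) x) = (\<integral>\<^sup>+n. ennreal (tail (iid_sum a n) x) \<partial>measure_pmf p)"
    unfolding nn_integral_pmf_indicator[symmetric] nn_integral_compound ..
  also have "\<dots> = ennreal (\<integral>n. tail (iid_sum a n) x \<partial>measure_pmf p)"
    by (intro nn_integral_eq_integral measure_pmf.integrable_const_bound[where B = 1]) auto
  finally show ?thesis by (simp add: Bochner_Integration.integral_nonneg)
qed

context heavy_tailed_offspring begin

lemma nn_mean_iid_sum: "(\<integral>\<^sup>+s. ennreal (real s) \<partial>measure_pmf (iid_sum a n)) = ennreal (real n * \<mu>)"
proof (induction n)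
  case (Suc n)
  have "(\<integral>\<^sup>+y. ennreal (real (s + y)) \<partial>measure_pmf a) = ennreal (real s) + ennreal \<mu>" for s
    using mean by (simp add: nn_integral_add ennreal_plus del: ennreal_of_nat_eq_real_of_nat)
  then have "(\<integral>\<^sup>+s. ennreal (real s) \<partial>measure_pmf (iid_sum a (Suc n))) = ennreal (real n * \<mu>) + ennreal \<mu>"
    unfolding nn_integral_iid_sum_Suc using Suc by (simp add: nn_integral_add)
  also have "\<dots> = ennreal (real (Suc n) * \<mu>)"
    using mean_pos by (subst ennreal_plus[symmetric]) (auto simp: algebra_simps)
  finally show ?case .
qed simp

lemma nn_mean_compound:
  "(\<integral>\<^sup>+s. ennreal (real s) \<partial>measure_pmf (compound a p)) = ennreal \<mu> * (\<integral>\<^sup>+n. ennreal (real n) \<partial>measure_pmf p)"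
proof -
  have "ennreal (real n * \<mu>) = ennreal \<mu> * ennreal (real n)" for n
    using mean_pos by (simp add: ennreal_mult mult.commute)
  then show ?thesis by (simp add: nn_integral_compound nn_mean_iid_sum nn_integral_cmult del: ennreal_of_nat_eq_real_of_nat)
qed

lemma integrable_offspring: "integrable (measure_pmf a) real"
  and expectation_offspring: "(\<integral>n. real n \<partial>measure_pmf a) = \<mu>"
proof -
  show int: "integrable (measure_pmf a) real"
    by (rule integrableI_nonneg) (auto simp: mean)
  show "(\<integral>n. real n \<partial>measure_pmf a) = \<mu>"
    using nn_integral_eq_integral[OF int] mean mean_pos by (simp add: Bochner_Integration.integral_nonneg)
qed

definition deviation :: "real \<Rightarrow> ennreal" where
  "deviation x = (\<integral>\<^sup>+n. ennreal (huber ((real n - \<mu>) / x)) \<partial>measure_pmf a)"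

text \<open>The linear term of \<open>huber_add\<close> integrates to zero.\<close>

lemma huber_centred_step:
  assumes "0 < x"
  shows "(\<integral>\<^sup>+n. ennreal (huber (z + (real n - \<mu>) / x)) \<partial>measure_pmf a) \<le> ennreal (huber z) + 2 * deviation x"
proof -
  note [simp] = integrable_offspring
  have int: "integrable (measure_pmf a) (\<lambda>n. (real n - \<mu>) / x)"
    by (intro integrable_divide Bochner_Integration.integrable_diff) auto
  have inth: "integrable (measure_pmf a) (\<lambda>n. huber ((real n - \<mu>) / x))"
    by (rule Bochner_Integration.integrable_bound[where f = "\<lambda>n. 2 * ((real n - \<mu>) / x)"])
       (use int in \<open>simp_all only: integrable_mult_right AE_I2 norm_huber_le, simp\<close>)
  have "(\<integral>n. (real n - \<mu>) / x \<partial>measure_pmf a) = 0"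
    by (simp add: expectation_offspring)
  then have eq: "(\<integral>n. huber z + 2 * clip z * ((real n - \<mu>) / x) + 2 * huber ((real n - \<mu>) / x) \<partial>measure_pmf a)
      = huber z + 2 * (\<integral>n. huber ((real n - \<mu>) / x) \<partial>measure_pmf a)"
    using int inth
    by (simp del: times_divide_eq_right integral_divide_zero add: Bochner_Integration.integral_add)
  have intz: "integrable (measure_pmf a) (\<lambda>n. huber (z + (real n - \<mu>) / x))"
  proof (rule Bochner_Integration.integrable_bound[where f = "\<lambda>n. 2 * (z + (real n - \<mu>) / x)"])
    show "integrable (measure_pmf a) (\<lambda>n. 2 * (z + (real n - \<mu>) / x))"
      by (intro integrable_mult_right Bochner_Integration.integrable_add int) auto
  qed (simp_all only: AE_I2 norm_huber_le, simp)
  have "(\<integral>\<^sup>+n. ennreal (huber (z + (real n - \<mu>) / x)) \<partial>measure_pmf a)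
      = ennreal (\<integral>n. huber (z + (real n - \<mu>) / x) \<partial>measure_pmf a)"
    by (intro nn_integral_eq_integral intz) auto
  also have "\<dots> \<le> ennreal (huber z + 2 * (\<integral>n. huber ((real n - \<mu>) / x) \<partial>measure_pmf a))"
    unfolding eq[symmetric]
    by (intro ennreal_leI integral_mono intz Bochner_Integration.integrable_add integrable_mult_right int inth huber_add) auto
  also have "\<dots> = ennreal (huber z) + 2 * deviation x"
    unfolding deviation_def using inth
    by (subst nn_integral_eq_integral) (auto simp: ennreal_plus ennreal_mult Bochner_Integration.integral_nonneg)
  finally show ?thesis .
qed

text \<open>Adding the centred summands one at a time, each costs \<open>2 deviation x\<close>, whatever the current value of
  the sum. The offset \<open>z\<close> is needed for the induction, and later carries the conditional mean \<open>\<mu> n / x\<close>.\<close>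

lemma huber_iid_sum:
  assumes "0 < x"
  shows "(\<integral>\<^sup>+s. ennreal (huber (z + (real s - real n * \<mu>) / x)) \<partial>measure_pmf (iid_sum a n))
    \<le> ennreal (huber z) + 2 * of_nat n * deviation x"
proof (induction n)
  case (Suc n)
  have "(\<integral>\<^sup>+s. ennreal (huber (z + (real s - real (Suc n) * \<mu>) / x)) \<partial>measure_pmf (iid_sum a (Suc n)))
     = (\<integral>\<^sup>+s. \<integral>\<^sup>+y. ennreal (huber ((z + (real s - real n * \<mu>) / x) + (real y - \<mu>) / x)) \<partial>measure_pmf a \<partial>measure_pmf (iid_sum a n))"
    unfolding nn_integral_iid_sum_Suc
    by (intro nn_integral_cong arg_cong[where f = ennreal] arg_cong[where f = huber])
       (simp add: field_simps add_divide_distrib diff_divide_distrib)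
  also have "\<dots> \<le> (\<integral>\<^sup>+s. ennreal (huber (z + (real s - real n * \<mu>) / x)) + 2 * deviation x \<partial>measure_pmf (iid_sum a n))"
    by (intro nn_integral_mono huber_centred_step assms)
  also have "\<dots> = (\<integral>\<^sup>+s. ennreal (huber (z + (real s - real n * \<mu>) / x)) \<partial>measure_pmf (iid_sum a n)) + 2 * deviation x"
    by (subst nn_integral_add) auto
  also have "\<dots> \<le> ennreal (huber z) + 2 * of_nat n * deviation x + 2 * deviation x"
    by (intro add_right_mono Suc)
  finally show ?case by (simp add: algebra_simps)
qed simp

lemma deviation_bound:
  obtains K x0 where "0 < K" "0 < x0" "\<And>x. x0 \<le> x \<Longrightarrow> deviation x \<le> ennreal (K * tail a x)"
proof -
  obtain K1 x1 where 1: "0 < K1" "0 < x1"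
    "\<And>x. x1 \<le> x \<Longrightarrow> (\<integral>\<^sup>+n. ennreal (huber (real n / x)) \<partial>measure_pmf a) \<le> ennreal (K1 * tail a x)"
    by (rule huber_moment_bound[OF dominated_offspring]) blast
  obtain K2 x2 where 2: "0 < K2" "0 < x2" "\<And>x. x2 \<le> x \<Longrightarrow> 1 / x\<^sup>2 \<le> K2 * tail a x"
    by (rule inverse_square_le_tail) blast
  show thesis
  proof (rule that[of "K1 + 2 * \<mu>\<^sup>2 * K2" "max x1 x2"])
    fix x assume x: "max x1 x2 \<le> x"
    then have x0: "0 < x" using 1 by auto
    have "huber ((real n - \<mu>) / x) \<le> huber (real n / x) + 2 * \<mu>\<^sup>2 * (K2 * tail a x)" for n
    proof -
      have "huber ((real n - \<mu>) / x) \<le> huber (real n / x) + 2 * clip (real n / x) * (- (\<mu> / x)) + 2 * huber (- (\<mu> / x))"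
        using huber_add[of "real n / x" "- (\<mu> / x)"] by (simp add: diff_divide_distrib)
      moreover have "0 \<le> clip (real n / x)" using x0 by (simp add: clip_def le_max_iff_disj)
      then have "0 \<le> clip (real n / x) * (\<mu> / x)"
        using x0 mean_pos by (intro mult_nonneg_nonneg) auto
      moreover have "huber (- (\<mu> / x)) \<le> \<mu>\<^sup>2 * (1 / x\<^sup>2)"
        using huber_le_square[of "\<mu> / x"] by (simp add: power_divide)
      moreover have "\<mu>\<^sup>2 * (1 / x\<^sup>2) \<le> \<mu>\<^sup>2 * (K2 * tail a x)"
        using 2 x by (intro mult_left_mono) auto
      ultimately show ?thesis by (simp only: mult.assoc mult_minus_right)
    qed
    then have "deviation x \<le> (\<integral>\<^sup>+n. ennreal (huber (real n / x)) + ennreal (2 * \<mu>\<^sup>2 * (K2 * tail a x)) \<partial>measure_pmf a)"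
      unfolding deviation_def using 2 by (intro nn_integral_mono) (simp flip: ennreal_plus add: ennreal_leI)
    also have "\<dots> = (\<integral>\<^sup>+n. ennreal (huber (real n / x)) \<partial>measure_pmf a) + ennreal (2 * \<mu>\<^sup>2 * (K2 * tail a x))"
      by (subst nn_integral_add) auto
    also have "\<dots> \<le> ennreal (K1 * tail a x) + ennreal (2 * \<mu>\<^sup>2 * (K2 * tail a x))"
      using 1 x by (intro add_right_mono) auto
    also have "\<dots> = ennreal ((K1 + 2 * \<mu>\<^sup>2 * K2) * tail a x)"
      using 1 2 by (simp flip: ennreal_plus) (simp add: algebra_simps)
    finally show "deviation x \<le> ennreal ((K1 + 2 * \<mu>\<^sup>2 * K2) * tail a x)" .
  next
    show "0 < K1 + 2 * \<mu>\<^sup>2 * K2" using 1 2 by (intro add_pos_nonneg) auto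
  qed (use 1 2 in auto)
qed

text \<open>Markov's inequality, since the Huber function is at least 1 outside \<open>(-1, 1)\<close>.\<close>

lemma iid_sum_deviation:
  assumes "0 < y"
  shows "emeasure (measure_pmf (iid_sum a n)) {s. y \<le> \<bar>real s - real n * \<mu>\<bar>} \<le> 2 * of_nat n * deviation y"
proof -
  have "emeasure (measure_pmf (iid_sum a n)) {s. y \<le> \<bar>real s - real n * \<mu>\<bar>}
      = (\<integral>\<^sup>+s. indicator {s. y \<le> \<bar>real s - real n * \<mu>\<bar>} s \<partial>measure_pmf (iid_sum a n))" by simp
  also have "\<dots> \<le> (\<integral>\<^sup>+s. ennreal (huber (0 + (real s - real n * \<mu>) / y)) \<partial>measure_pmf (iid_sum a n))"
  proof (intro nn_integral_mono)
    fix s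
    have "1 \<le> huber ((real s - real n * \<mu>) / y)" if "y \<le> \<bar>real s - real n * \<mu>\<bar>"
    proof -
      have one_le_abs: "1 \<le> \<bar>(real s - real n * \<mu>) / y\<bar>"
        using that assms by (simp add: abs_divide)
      consider "1 \<le> (real s - real n * \<mu>) / y" | "1 \<le> - ((real s - real n * \<mu>) / y)"
        using one_le_abs by linarith
      then show ?thesis
      proof cases
        case 1 then show ?thesis using huber_ge_level[of 1] by simp
      next
        case 2 then show ?thesis using huber_ge_level[of 1 "- ((real s - real n * \<mu>) / y)"] by simp
      qed
    qed
    then show "indicator {s. y \<le> \<bar>real s - real n * \<mu>\<bar>} s \<le> ennreal (huber (0 + (real s - real n * \<mu>) / y))"
      by (auto simp: indicator_def)
  qed
  also have "\<dots> \<le> 2 * of_nat n * deviation y"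
    using huber_iid_sum[OF assms, where z = 0 and n = n] by simp
  finally show ?thesis .
qed

lemma iid_sum_deviation_bound:
  obtains K x0 where "0 < K" "0 < x0"
    "\<And>y n. x0 \<le> y \<Longrightarrow> measure_pmf.prob (iid_sum a n) {s. y \<le> \<bar>real s - real n * \<mu>\<bar>} \<le> K * real n * tail a y"
proof -
  obtain K x0 where K: "0 < K" "0 < x0" "\<And>x. x0 \<le> x \<Longrightarrow> deviation x \<le> ennreal (K * tail a x)"
    by (rule deviation_bound) blast
  show thesis
  proof (rule that[of "2 * K" x0])
    fix y n assume y: "x0 \<le> y"
    have "emeasure (measure_pmf (iid_sum a n)) {s. y \<le> \<bar>real s - real n * \<mu>\<bar>} \<le> 2 * of_nat n * deviation y"
      using y K by (intro iid_sum_deviation) auto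
    also have "\<dots> \<le> 2 * of_nat n * ennreal (K * tail a y)"
      using K y by (intro mult_left_mono) auto
    also have "\<dots> = ennreal (2 * K * real n * tail a y)"
      using K by (simp add: ennreal_of_nat_eq_real_of_nat ennreal_mult mult_ac)
    finally show "measure_pmf.prob (iid_sum a n) {s. y \<le> \<bar>real s - real n * \<mu>\<bar>} \<le> 2 * K * real n * tail a y"
      using K by (simp add: measure_pmf.emeasure_eq_measure)
  qed (use K in auto)
qed

text \<open>Conditionally on the number \<open>n\<close> of summands, the offset is \<open>z = \<mu> n / x\<close>.\<close>

lemma huber_compound:
  assumes "0 < x"
  shows "(\<integral>\<^sup>+s. ennreal (huber (real s / x)) \<partial>measure_pmf (compound a p))
    \<le> (\<integral>\<^sup>+n. ennreal (huber (real n / (x / \<mu>))) \<partial>measure_pmf p)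
      + 2 * deviation x * (\<integral>\<^sup>+n. ennreal (real n) \<partial>measure_pmf p)"
proof -
  have "(\<integral>\<^sup>+s. ennreal (huber (real s / x)) \<partial>measure_pmf (iid_sum a n))
      \<le> ennreal (huber (real n / (x / \<mu>))) + 2 * deviation x * ennreal (real n)" for n
    using huber_iid_sum[OF assms, where z = "real n / (x / \<mu>)" and n = n]
    by (simp add: diff_divide_distrib ennreal_of_nat_eq_real_of_nat mult_ac)
  then have "(\<integral>\<^sup>+s. ennreal (huber (real s / x)) \<partial>measure_pmf (compound a p))
      \<le> (\<integral>\<^sup>+n. ennreal (huber (real n / (x / \<mu>))) + 2 * deviation x * ennreal (real n) \<partial>measure_pmf p)"
    unfolding nn_integral_compound by (intro nn_integral_mono)
  also have "\<dots> = (\<integral>\<^sup>+n. ennreal (huber (real n / (x / \<mu>))) \<partial>measure_pmf p)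
      + 2 * deviation x * (\<integral>\<^sup>+n. ennreal (real n) \<partial>measure_pmf p)"
    by (subst nn_integral_add) (auto simp: nn_integral_cmult)
  finally show ?thesis .
qed

end

section \<open>Sums of two independent heavy-tailed variables\<close>

text \<open>The relations \<open>limsup f \<le> l\<close> and \<open>liminf f \<ge> l\<close> at infinity, phrased so that the auxiliary
  parameters of an estimate can be sent to their limits one after the other.\<close>

definition limsup_le :: "(real \<Rightarrow> real) \<Rightarrow> real \<Rightarrow> bool" where
  "limsup_le f l \<longleftrightarrow> (\<forall>a>l. eventually (\<lambda>x. f x < a) at_top)"

definition liminf_ge :: "(real \<Rightarrow> real) \<Rightarrow> real \<Rightarrow> bool" where
  "liminf_ge f l \<longleftrightarrow> (\<forall>a<l. eventually (\<lambda>x. a < f x) at_top)"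

lemma tendsto_iff_limsup_liminf: "(f \<longlongrightarrow> l) at_top \<longleftrightarrow> limsup_le f l \<and> liminf_ge f l"
  unfolding limsup_le_def liminf_ge_def by (auto simp: order_tendsto_iff)

lemma limsup_leI: "eventually (\<lambda>x. f x \<le> h x) at_top \<Longrightarrow> (h \<longlongrightarrow> l) at_top \<Longrightarrow> limsup_le f l"
  unfolding limsup_le_def by (auto dest: order_tendstoD(2) elim: eventually_elim2)

lemma liminf_geI: "eventually (\<lambda>x. h x \<le> f x) at_top \<Longrightarrow> (h \<longlongrightarrow> l) at_top \<Longrightarrow> liminf_ge f l"
  unfolding liminf_ge_def by (auto dest: order_tendstoD(1) elim: eventually_elim2)

lemma limsup_le_mono: "limsup_le h l \<Longrightarrow> (\<And>x. f x \<le> h x) \<Longrightarrow> limsup_le f l"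
  unfolding limsup_le_def by (meson eventually_mono le_less_trans)

lemma liminf_ge_mono: "liminf_ge h l \<Longrightarrow> (\<And>x. h x \<le> f x) \<Longrightarrow> liminf_ge f l"
  unfolding liminf_ge_def by (meson eventually_mono less_le_trans)

lemma limsup_le_limit:
  assumes "(u \<longlongrightarrow> l) F" "F \<noteq> bot" "eventually (\<lambda>e. limsup_le f (u e)) F"
  shows "limsup_le f l"
  unfolding limsup_le_def
proof (intro allI impI)
  fix a assume "l < a"
  then have "eventually (\<lambda>e. u e < a) F" using assms(1) by (rule order_tendstoD(2)[rotated])
  with assms(3) have "eventually (\<lambda>e. u e < a \<and> limsup_le f (u e)) F" by eventually_elim auto
  then obtain e where "u e < a" "limsup_le f (u e)" using eventually_happens'[OF assms(2)] by blast
  then show "eventually (\<lambda>x. f x < a) at_top" by (auto simp: limsup_le_def)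
qed

lemma liminf_ge_limit:
  assumes "(u \<longlongrightarrow> l) F" "F \<noteq> bot" "eventually (\<lambda>e. liminf_ge f (u e)) F"
  shows "liminf_ge f l"
  unfolding liminf_ge_def
proof (intro allI impI)
  fix a assume "a < l"
  then have "eventually (\<lambda>e. a < u e) F" using assms(1) by (rule order_tendstoD(1)[rotated])
  with assms(3) have "eventually (\<lambda>e. a < u e \<and> liminf_ge f (u e)) F" by eventually_elim auto
  then obtain e where "a < u e" "liminf_ge f (u e)" using eventually_happens'[OF assms(2)] by blast
  then show "eventually (\<lambda>x. a < f x) at_top" by (auto simp: liminf_ge_def)
qed

lemma eventually_between_0_1: "eventually (\<lambda>e::real. 0 < e \<and> e < 1) (at_right 0)"
  unfolding eventually_at_right[OF zero_less_one] by (intro exI[of _ 1]) auto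

context heavy_tailed_offspring begin

lemma tail_scaling:
  assumes "((\<lambda>x. F x / tail a x) \<longlongrightarrow> c) at_top" "0 < l"
  shows "((\<lambda>x. F (l * x) / tail a x) \<longlongrightarrow> c * l powr (-\<alpha>)) at_top"
proof -
  have "filterlim (\<lambda>x. l * x) at_top at_top"
    using assms(2) by (rule filterlim_tendsto_pos_mult_at_top[OF tendsto_const _ filterlim_ident])
  then have "((\<lambda>x. F (l * x) / tail a (l * x)) \<longlongrightarrow> c) at_top"
    by (rule filterlim_compose[OF assms(1)])
  then have "((\<lambda>x. (F (l * x) / tail a (l * x)) * (tail a (l * x) / tail a x)) \<longlongrightarrow> c * l powr (-\<alpha>)) at_top"
    by (intro tendsto_mult tail_ratio assms(2))
  moreover have "(F (l * x) / tail a (l * x)) * (tail a (l * x) / tail a x) = F (l * x) / tail a x" for x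
    using tail_pos[of "l * x"] by simp
  ultimately show ?thesis by (simp only:)
qed

lemma tail_limit_imp_null:
  assumes "((\<lambda>x. F x / tail a x) \<longlongrightarrow> c) at_top"
  shows "(F \<longlongrightarrow> 0) at_top"
proof -
  have "((\<lambda>x. F x / tail a x * tail a x) \<longlongrightarrow> c * 0) at_top"
    by (intro tendsto_mult assms tail_tendsto_0)
  then show ?thesis using tail_pos by (simp add: less_imp_neq[symmetric])
qed

text \<open>Principle of a single big jump. If \<open>U + V > x\<close>, then \<open>U > (1 - e) x\<close>, or \<open>V > (1 - e) x\<close>, or both
  exceed \<open>e x\<close>; the last event has probability of order \<open>(g x)\<^sup>2\<close> by independence. Conversely, it
  suffices that one of them exceeds \<open>x\<close>.\<close>

lemma tail_sum_indep:
  assumes "prob_space M" and [measurable]: "U \<in> borel_measurable M" "V \<in> borel_measurable M"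
    and nonneg: "\<And>\<omega>. 0 \<le> U \<omega>" "\<And>\<omega>. 0 \<le> V \<omega>"
    and indep: "\<And>x. \<P>(\<omega> in M. x < U \<omega> \<and> x < V \<omega>) = \<P>(\<omega> in M. x < U \<omega>) * \<P>(\<omega> in M. x < V \<omega>)"
    and U: "((\<lambda>x. \<P>(\<omega> in M. x < U \<omega>) / tail a x) \<longlongrightarrow> u) at_top"
    and V: "((\<lambda>x. \<P>(\<omega> in M. x < V \<omega>) / tail a x) \<longlongrightarrow> v) at_top"
  shows "((\<lambda>x. \<P>(\<omega> in M. x < U \<omega> + V \<omega>) / tail a x) \<longlongrightarrow> u + v) at_top"
proof -
  interpret prob_space M by fact
  define F where "F x = \<P>(\<omega> in M. x < U \<omega>)" for x
  define G where "G x = \<P>(\<omega> in M. x < V \<omega>)" for x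
  define H where "H x = \<P>(\<omega> in M. x < U \<omega> + V \<omega>)" for x
  have F: "((\<lambda>x. F x / tail a x) \<longlongrightarrow> u) at_top" and G: "((\<lambda>x. G x / tail a x) \<longlongrightarrow> v) at_top"
    using U V by (simp_all add: F_def G_def)
  have FG: "((\<lambda>x. F x * G x / tail a x) \<longlongrightarrow> 0) at_top"
    using tendsto_mult[OF tail_limit_imp_null[OF F] G] by simp
  have lower: "F x + G x - F x * G x \<le> H x" for x
  proof -
    have "F x + G x - F x * G x = prob ({\<omega>\<in>space M. x < U \<omega>} \<union> {\<omega>\<in>space M. x < V \<omega>})"
    proof -
      have "{\<omega>\<in>space M. x < U \<omega>} \<inter> {\<omega>\<in>space M. x < V \<omega>} = {\<omega>\<in>space M. x < U \<omega> \<and> x < V \<omega>}" by auto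
      then show ?thesis using indep[of x]
        by (subst measure_Un3) (auto simp: F_def G_def fmeasurable_eq_sets)
    qed
    also have "\<dots> \<le> H x"
      unfolding H_def
    proof (rule finite_measure_mono)
      have "x < U \<omega> \<or> x < V \<omega> \<Longrightarrow> x < U \<omega> + V \<omega>" for \<omega>
        using nonneg[of \<omega>] by linarith
      then show "{\<omega>\<in>space M. x < U \<omega>} \<union> {\<omega>\<in>space M. x < V \<omega>} \<subseteq> {\<omega>\<in>space M. x < U \<omega> + V \<omega>}"
        by auto
    qed simp
    finally show ?thesis .
  qed
  have "liminf_ge (\<lambda>x. H x / tail a x) (u + v - 0)"
  proof (rule liminf_geI)
    show "((\<lambda>x. F x / tail a x + G x / tail a x - F x * G x / tail a x) \<longlongrightarrow> u + v - 0) at_top"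
      by (intro tendsto_intros F G FG)
    show "eventually (\<lambda>x. F x / tail a x + G x / tail a x - F x * G x / tail a x \<le> H x / tail a x) at_top"
    proof (rule always_eventually, rule allI)
      fix x
      show "F x / tail a x + G x / tail a x - F x * G x / tail a x \<le> H x / tail a x"
        using divide_right_mono[OF lower[of x] less_imp_le[OF tail_pos[of x]]]
        by (simp add: add_divide_distrib diff_divide_distrib)
    qed
  qed
  moreover have "limsup_le (\<lambda>x. H x / tail a x) (u + v)"
  proof (rule limsup_le_limit)
    show "((\<lambda>e. u * (1 - e) powr (-\<alpha>) + v * (1 - e) powr (-\<alpha>)) \<longlongrightarrow> u + v) (at_right 0)"
      by (auto intro!: tendsto_eq_intros)
    have "eventually (\<lambda>e::real. 0 < e \<and> e < 1) (at_right 0)"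
      by (rule eventually_between_0_1)
    then show "eventually (\<lambda>e. limsup_le (\<lambda>x. H x / tail a x) (u * (1 - e) powr (-\<alpha>) + v * (1 - e) powr (-\<alpha>))) (at_right 0)"
    proof eventually_elim
      case (elim e)
      have upper: "H x \<le> F ((1 - e) * x) + G ((1 - e) * x) + F (e * x) * G (e * x)" for x
      proof -
        let ?U = "\<lambda>y. {\<omega>\<in>space M. y < U \<omega>}" and ?V = "\<lambda>y. {\<omega>\<in>space M. y < V \<omega>}"
        have "H x \<le> prob (?U ((1 - e) * x) \<union> ?V ((1 - e) * x) \<union> {\<omega>\<in>space M. e * x < U \<omega> \<and> e * x < V \<omega>})"
          unfolding H_def
        proof (rule finite_measure_mono)
          show "{\<omega>\<in>space M. x < U \<omega> + V \<omega>}
            \<subseteq> ?U ((1 - e) * x) \<union> ?V ((1 - e) * x) \<union> {\<omega>\<in>space M. e * x < U \<omega> \<and> e * x < V \<omega>}"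
            by (auto simp: algebra_simps)
        qed auto
        also have "\<dots> \<le> prob (?U ((1 - e) * x)) + prob (?V ((1 - e) * x)) + prob {\<omega>\<in>space M. e * x < U \<omega> \<and> e * x < V \<omega>}"
          by (intro order_trans[OF measure_Un_le] add_right_mono) auto
        finally show ?thesis by (simp add: F_def G_def indep)
      qed
      show ?case
      proof (rule limsup_leI)
        have "((\<lambda>x. F (e * x) * G (e * x) / tail a x) \<longlongrightarrow> 0 * e powr (-\<alpha>)) at_top"
          using elim by (intro tail_scaling[of "\<lambda>x. F x * G x"] FG) auto
        then show "((\<lambda>x. F ((1 - e) * x) / tail a x + G ((1 - e) * x) / tail a x + F (e * x) * G (e * x) / tail a x)
            \<longlongrightarrow> u * (1 - e) powr (-\<alpha>) + v * (1 - e) powr (-\<alpha>)) at_top"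
          using elim tendsto_add[OF tendsto_add[OF tail_scaling[OF F, of "1 - e"] tail_scaling[OF G, of "1 - e"]]]
          by fastforce
        show "eventually (\<lambda>x. H x / tail a x \<le> F ((1 - e) * x) / tail a x + G ((1 - e) * x) / tail a x
            + F (e * x) * G (e * x) / tail a x) at_top"
        proof (rule always_eventually, rule allI)
          fix x
          show "H x / tail a x \<le> F ((1 - e) * x) / tail a x + G ((1 - e) * x) / tail a x + F (e * x) * G (e * x) / tail a x"
            using divide_right_mono[OF upper[of x] less_imp_le[OF tail_pos[of x]]]
            by (simp add: add_divide_distrib)
        qed
      qed
    qed
  qed simp
  ultimately show ?thesis by (simp add: tendsto_iff_limsup_liminf H_def)
qed

lemma tail_iid_sum: "((\<lambda>x. tail (iid_sum a n) x / tail a x) \<longlongrightarrow> real n) at_top"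
proof (induction n)
  case 0
  have "eventually (\<lambda>x. tail (iid_sum a 0) x / tail a x = 0) at_top"
    using eventually_ge_at_top[of 0] by eventually_elim (auto simp: tail_def)
  then show ?case by (simp add: tendsto_eventually)
next
  case (Suc n)
  let ?M = "measure_pmf (pair_pmf (iid_sum a n) a)"
  have fst: "measure ?M {\<omega>. x < real (fst \<omega>)} = tail (iid_sum a n) x" for x
  proof -
    have "tail (map_pmf fst (pair_pmf (iid_sum a n) a)) x = measure ?M {\<omega>. x < real (fst \<omega>)}"
      unfolding tail_def measure_map_pmf by (simp add: vimage_def)
    then show ?thesis by (simp add: map_fst_pair_pmf)
  qed
  have snd: "measure ?M {\<omega>. x < real (snd \<omega>)} = tail a x" for x
  proof -
    have "tail (map_pmf snd (pair_pmf (iid_sum a n) a)) x = measure ?M {\<omega>. x < real (snd \<omega>)}"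
      unfolding tail_def measure_map_pmf by (simp add: vimage_def)
    then show ?thesis by (simp add: map_snd_pair_pmf)
  qed
  have both: "measure ?M {\<omega>. x < real (fst \<omega>) \<and> x < real (snd \<omega>)} = tail (iid_sum a n) x * tail a x" for x
  proof -
    have "{\<omega>. x < real (fst \<omega>) \<and> x < real (snd \<omega>)} = {n. x < real n} \<times> {n. x < real n}" by auto
    then show ?thesis by (simp add: tail_def measure_pmf_prob_product)
  qed
  have sum: "measure ?M {\<omega>. x < real (fst \<omega>) + real (snd \<omega>)} = tail (iid_sum a (Suc n)) x" for x
    unfolding tail_def by (simp add: vimage_def case_prod_beta)
  have "((\<lambda>x. \<P>(\<omega> in ?M. x < real (fst \<omega>) + real (snd \<omega>)) / tail a x) \<longlongrightarrow> real n + 1) at_top"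
    using Suc tail_pos
    by (intro tail_sum_indep) (auto simp: fst snd both measure_pmf.prob_space_axioms less_imp_neq[symmetric])
  then show ?case by (simp add: sum add.commute)
qed

end

section \<open>The tail of a random sum\<close>

context heavy_tailed_offspring begin

lemma dominated_if_tendsto:
  assumes "((\<lambda>x. tail p x / tail a x) \<longlongrightarrow> c) at_top"
  shows "dominated p"
proof -
  have "eventually (\<lambda>x. tail p x / tail a x < c + 1) at_top"
    using order_tendstoD(2)[OF assms, of "c + 1"] by simp
  then have "eventually (\<lambda>x. tail p x \<le> (c + 1) * tail a x) at_top"
    by eventually_elim (use tail_pos in \<open>simp add: field_simps less_imp_le\<close>)
  then show ?thesis unfolding dominated_def by blast
qed

text \<open>Dominated convergence, as \<open>x P(A > x) \<le> E(A; A > x)\<close> and \<open>A\<close> has a finite mean.\<close>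

lemma times_tail_tendsto_0: "((\<lambda>x. x * tail a x) \<longlongrightarrow> 0) at_top"
proof (rule tendsto_sandwich[OF _ _ tendsto_const])
  have "((\<lambda>x. \<integral>n. real n * indicator {n. x < real n} n \<partial>measure_pmf a) \<longlongrightarrow> (\<integral>n. 0 \<partial>measure_pmf a)) at_top"
  proof (rule integral_dominated_convergence_at_top[where w = real])
    show "AE n in measure_pmf a. ((\<lambda>x. real n * indicator {n. x < real n} n) \<longlongrightarrow> 0) at_top"
    proof (rule AE_I2)
      fix n :: nat
      have "eventually (\<lambda>x. real n * indicator {n. x < real n} n = 0) at_top"
        using eventually_ge_at_top[of "real n"] by eventually_elim auto
      then show "((\<lambda>x. real n * indicator {n. x < real n} n) \<longlongrightarrow> 0) at_top"
        by (rule tendsto_eventually)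
    qed
  qed (auto simp: indicator_def integrable_offspring)
  then show "((\<lambda>x. \<integral>n. real n * indicator {n. x < real n} n \<partial>measure_pmf a) \<longlongrightarrow> 0) at_top" by simp
  show "eventually (\<lambda>x. 0 \<le> x * tail a x) at_top"
    using eventually_ge_at_top[of 0] by eventually_elim auto
  show "eventually (\<lambda>x. x * tail a x \<le> (\<integral>n. real n * indicator {n. x < real n} n \<partial>measure_pmf a)) at_top"
    using eventually_ge_at_top[of 0]
  proof eventually_elim
    case (elim x)
    have "x * tail a x = (\<integral>n. x * indicator {n. x < real n} n \<partial>measure_pmf a)" by (simp add: tail_def)
    also have "\<dots> \<le> (\<integral>n. real n * indicator {n. x < real n} n \<partial>measure_pmf a)"
    proof (rule integral_mono)
      show "integrable (measure_pmf a) (\<lambda>n. real n * indicator {n. x < real n} n)"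
        by (rule Bochner_Integration.integrable_bound[OF integrable_offspring]) (auto simp: indicator_def)
      show "integrable (measure_pmf a) (\<lambda>n. x * indicator {n. x < real n} n)"
        by (intro integrable_mult_right) (simp add: measure_pmf.emeasure_eq_measure)
    qed (auto simp: indicator_def)
    finally show ?case .
  qed
qed

lemma truncated_sum_eq_integral:
  "(\<Sum>n\<le>m. f n * pmf p n) = (\<integral>n. f n * indicator {..m} n \<partial>measure_pmf p)" for f :: "nat \<Rightarrow> real"
  by (subst integral_measure_pmf_real[of "{..m}"]) (auto simp: indicator_def split: if_splits)

lemma truncated_mean_tendsto:
  assumes "integrable (measure_pmf p) real"
  shows "(\<lambda>m. \<Sum>n\<le>m. real n * pmf p n) \<longlonglongrightarrow> (\<integral>n. real n \<partial>measure_pmf p)"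
  unfolding truncated_sum_eq_integral
proof (rule integral_dominated_convergence[where w = real])
  show "AE n in measure_pmf p. (\<lambda>m. real n * indicator {..m} n) \<longlonglongrightarrow> real n"
  proof (rule AE_I2)
    fix n
    have "eventually (\<lambda>m. real n * indicator {..m} n = real n) sequentially"
      using eventually_ge_at_top[of n] by eventually_elim auto
    then show "(\<lambda>m. real n * indicator {..m} n) \<longlonglongrightarrow> real n" by (rule tendsto_eventually)
  qed
qed (auto simp: assms indicator_def)

lemma truncated_compound_tail:
  "((\<lambda>x. (\<Sum>n\<le>m. tail (iid_sum a n) x * pmf p n) / tail a x) \<longlongrightarrow> (\<Sum>n\<le>m. real n * pmf p n)) at_top"
proof -
  have "((\<lambda>x. \<Sum>n\<le>m. tail (iid_sum a n) x / tail a x * pmf p n) \<longlongrightarrow> (\<Sum>n\<le>m. real n * pmf p n)) at_top"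
    by (intro tendsto_intros tail_iid_sum)
  then show ?thesis by (simp add: sum_divide_distrib)
qed

lemma integrable_tail_iid_sum: "integrable (measure_pmf p) (\<lambda>n. tail (iid_sum a n) x)"
  by (rule measure_pmf.integrable_const_bound[where B = 1]) auto

lemma integrable_indicator_pmf: "integrable (measure_pmf p) (\<lambda>n. indicator A n :: real)"
  by (simp add: measure_pmf.emeasure_eq_measure)

lemma integrable_restrict_pmf:
  "integrable (measure_pmf p) f \<Longrightarrow> integrable (measure_pmf p) (\<lambda>n. f n * indicator A n)" for f :: "nat \<Rightarrow> real"
  by (rule Bochner_Integration.integrable_bound[of _ f]) (auto simp: indicator_def)

text \<open>Split according to the number \<open>n\<close> of summands. For \<open>n \<le> m\<close> the tails of finite sums are known; for
  \<open>m < n \<le> (1 - e) x / \<mu>\<close> the sum deviates from its mean by at least \<open>e x\<close>, which costs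
  \<open>K n g(e x)\<close> and in total the tail of the series for \<open>E(N)\<close>; the remaining \<open>n\<close> have probability
  \<open>P(N > (1 - e) x / \<mu>)\<close>. Afterwards \<open>m\<close> tends to infinity.\<close>

lemma compound_tail_upper:
  assumes p: "((\<lambda>x. tail p x / tail a x) \<longlongrightarrow> c) at_top" and int: "integrable (measure_pmf p) real"
    and e: "0 < e" "e < 1"
  shows "limsup_le (\<lambda>x. tail (compound a p) x / tail a x)
    ((\<integral>n. real n \<partial>measure_pmf p) + c * ((1 - e) / \<mu>) powr (-\<alpha>))"
proof -
  obtain K x0 where K: "0 < K" "0 < x0"
    "\<And>y n. x0 \<le> y \<Longrightarrow> measure_pmf.prob (iid_sum a n) {s. y \<le> \<bar>real s - real n * \<mu>\<bar>} \<le> K * real n * tail a y"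
    by (rule iid_sum_deviation_bound) blast
  \<comment> \<open>\<open>R m\<close> is the part of the mean carried by values above \<open>m\<close>.\<close>
  define R where "R m = (\<integral>n. real n \<partial>measure_pmf p) - (\<Sum>n\<le>m. real n * pmf p n)" for m
  have R: "R m = (\<integral>n. real n * indicator {m<..} n \<partial>measure_pmf p)" for m
  proof -
    have "R m = (\<integral>n. real n - real n * indicator {..m} n \<partial>measure_pmf p)"
      unfolding R_def truncated_sum_eq_integral
      by (rule Bochner_Integration.integral_diff[symmetric]) (intro int integrable_restrict_pmf)+
    also have "\<dots> = (\<integral>n. real n * indicator {m<..} n \<partial>measure_pmf p)"
      by (intro Bochner_Integration.integral_cong) (auto simp: indicator_def)
    finally show ?thesis .
  qed
  have bound: "tail (compound a p) x \<le> (\<Sum>n\<le>m. tail (iid_sum a n) x * pmf p n)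
      + K * tail a (e * x) * R m + tail p ((1 - e) / \<mu> * x)" if x: "x0 / e \<le> x" for x m
  proof -
    have ex: "x0 \<le> e * x" using x e by (simp add: field_simps)
    have "tail (iid_sum a n) x \<le> tail (iid_sum a n) x * indicator {..m} n
      + K * tail a (e * x) * (real n * indicator {m<..} n) + indicator {n. (1 - e) / \<mu> * x < real n} n" for n
    proof -
      consider "n \<le> m" | "(1 - e) / \<mu> * x < real n" | "m < n" "real n \<le> (1 - e) / \<mu> * x" by linarith
      then show ?thesis
      proof cases
        case 1 then show ?thesis by simp
      next
        case 2
        have "tail (iid_sum a n) x \<le> 1" by simp
        with 2 show ?thesis using K by (simp add: add_increasing)
      next
        case 3
        have "real n * \<mu> \<le> (1 - e) * x" using 3 mean_pos by (simp add: field_simps)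
        then have "{s. x < real s} \<subseteq> {s. e * x \<le> \<bar>real s - real n * \<mu>\<bar>}"
          by (auto simp: algebra_simps)
        then have "tail (iid_sum a n) x \<le> measure_pmf.prob (iid_sum a n) {s. e * x \<le> \<bar>real s - real n * \<mu>\<bar>}"
          unfolding tail_def by (intro measure_pmf.finite_measure_mono) auto
        also have "\<dots> \<le> K * real n * tail a (e * x)" using K(3) ex by blast
        finally show ?thesis using 3 by (simp add: mult_ac)
      qed
    qed
    then have "tail (compound a p) x \<le> (\<integral>n. tail (iid_sum a n) x * indicator {..m} n
      + K * tail a (e * x) * (real n * indicator {m<..} n) + indicator {n. (1 - e) / \<mu> * x < real n} n \<partial>measure_pmf p)"
      unfolding tail_compound
      by (intro integral_mono Bochner_Integration.integrable_add integrable_mult_right integrable_restrict_pmf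
           integrable_tail_iid_sum integrable_indicator_pmf int)
    also have "\<dots> = (\<integral>n. tail (iid_sum a n) x * indicator {..m} n \<partial>measure_pmf p)
      + K * tail a (e * x) * (\<integral>n. real n * indicator {m<..} n \<partial>measure_pmf p)
      + (\<integral>n. indicator {n. (1 - e) / \<mu> * x < real n} n \<partial>measure_pmf p)"
      by (subst Bochner_Integration.integral_add, intro Bochner_Integration.integrable_add integrable_mult_right integrable_restrict_pmf
           integrable_tail_iid_sum integrable_indicator_pmf int, rule integrable_indicator_pmf,
          subst Bochner_Integration.integral_add, intro integrable_restrict_pmf integrable_tail_iid_sum,
          intro integrable_mult_right integrable_restrict_pmf int, simp only: integral_mult_right_zero)
    finally show ?thesis by (simp add: R truncated_sum_eq_integral tail_def)
  qed
  have "limsup_le (\<lambda>x. tail (compound a p) x / tail a x)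
      ((\<Sum>n\<le>m. real n * pmf p n) + K * R m * e powr (-\<alpha>) + c * ((1 - e) / \<mu>) powr (-\<alpha>))" for m
  proof (rule limsup_leI)
    show "eventually (\<lambda>x. tail (compound a p) x / tail a x \<le>
        (\<Sum>n\<le>m. tail (iid_sum a n) x * pmf p n) / tail a x + K * R m * (tail a (e * x) / tail a x)
        + tail p ((1 - e) / \<mu> * x) / tail a x) at_top"
      using eventually_ge_at_top[of "x0 / e"]
    proof eventually_elim
      case (elim x)
      show ?case using divide_right_mono[OF bound[OF elim, of m] less_imp_le[OF tail_pos[of x]]]
        by (simp add: add_divide_distrib mult_ac)
    qed
    have "0 < (1 - e) / \<mu>" using e mean_pos by simp
    then show "((\<lambda>x. (\<Sum>n\<le>m. tail (iid_sum a n) x * pmf p n) / tail a x + K * R m * (tail a (e * x) / tail a x)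
        + tail p ((1 - e) / \<mu> * x) / tail a x) \<longlongrightarrow>
        (\<Sum>n\<le>m. real n * pmf p n) + K * R m * e powr (-\<alpha>) + c * ((1 - e) / \<mu>) powr (-\<alpha>)) at_top"
      by (intro tendsto_add truncated_compound_tail tendsto_mult tendsto_const tail_ratio e tail_scaling p)
  qed
  moreover have "R \<longlonglongrightarrow> (\<integral>n. real n \<partial>measure_pmf p) - (\<integral>n. real n \<partial>measure_pmf p)"
    unfolding R_def[abs_def] by (intro tendsto_intros truncated_mean_tendsto int)
  then have "(\<lambda>m. (\<Sum>n\<le>m. real n * pmf p n) + K * R m * e powr (-\<alpha>) + c * ((1 - e) / \<mu>) powr (-\<alpha>))
      \<longlonglongrightarrow> (\<integral>n. real n \<partial>measure_pmf p) + K * 0 * e powr (-\<alpha>) + c * ((1 - e) / \<mu>) powr (-\<alpha>)"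
    by (intro tendsto_add tendsto_mult tendsto_const truncated_mean_tendsto int) simp
  ultimately show ?thesis
    by (intro limsup_le_limit[where F = sequentially]) auto
qed

text \<open>For \<open>n > (1 + e) x / \<mu>\<close> the event \<open>S\<^sub>n \<le> x\<close> requires a deviation of at least \<open>\<delta> n\<close> below the mean,
  which has probability at most \<open>K n g(\<delta> n)\<close> and so becomes negligible. The contribution of
  \<open>n \<le> m\<close> is disjoint from this range for large \<open>x\<close>.\<close>

lemma compound_tail_lower:
  assumes p: "((\<lambda>x. tail p x / tail a x) \<longlongrightarrow> c) at_top" and int: "integrable (measure_pmf p) real"
    and e: "0 < e"
  shows "liminf_ge (\<lambda>x. tail (compound a p) x / tail a x)
    ((\<integral>n. real n \<partial>measure_pmf p) + c * ((1 + e) / \<mu>) powr (-\<alpha>))"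
proof -
  obtain K x0 where K: "0 < K" "0 < x0"
    "\<And>y n. x0 \<le> y \<Longrightarrow> measure_pmf.prob (iid_sum a n) {s. y \<le> \<bar>real s - real n * \<mu>\<bar>} \<le> K * real n * tail a y"
    by (rule iid_sum_deviation_bound) blast
  \<comment> \<open>Chosen so that \<open>n \<mu> / (1 + e) = n \<mu> - \<delta> n\<close>.\<close>
  define \<delta> where "\<delta> = \<mu> * e / (1 + e)"
  have \<delta>: "0 < \<delta>" using e mean_pos by (simp add: \<delta>_def)
  define l where "l = (1 + e) / \<mu>"
  have l: "0 < l" using e mean_pos by (simp add: l_def)
  have fixed: "liminf_ge (\<lambda>x. tail (compound a p) x / tail a x)
      ((\<Sum>n\<le>m. real n * pmf p n) + (1 - \<eta>) * (c * l powr (-\<alpha>)))" if \<eta>: "0 < \<eta>" for m \<eta>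
  proof -
    have "((\<lambda>y. K / \<delta> * (y * tail a y)) \<longlongrightarrow> K / \<delta> * 0) at_top"
      by (intro tendsto_intros times_tail_tendsto_0)
    then have "eventually (\<lambda>y. K / \<delta> * (y * tail a y) < \<eta> \<and> x0 \<le> y) at_top"
      using \<eta> by (intro eventually_conj eventually_ge_at_top order_tendstoD(2)[of _ "K / \<delta> * 0"]) auto
    then obtain y0 where y0: "\<And>y. y0 \<le> y \<Longrightarrow> K / \<delta> * (y * tail a y) < \<eta> \<and> x0 \<le> y"
      by (auto simp: eventually_at_top_linorder)
    have large: "1 - \<eta> \<le> tail (iid_sum a n) x" if n: "l * x < real n" "y0 \<le> \<delta> * real n" for n x
    proof -
      have "x < real n * \<mu> / (1 + e)" using n(1) e mean_pos by (simp add: l_def field_simps)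
      also have "\<dots> = real n * \<mu> - \<delta> * real n" using e by (simp add: \<delta>_def field_simps)
      finally have x: "x < real n * \<mu> - \<delta> * real n" .
      have "measure_pmf.prob (iid_sum a n) (UNIV - {s. \<delta> * real n \<le> \<bar>real s - real n * \<mu>\<bar>}) \<le> tail (iid_sum a n) x"
        unfolding tail_def using x by (intro measure_pmf.finite_measure_mono) auto
      then have "1 - measure_pmf.prob (iid_sum a n) {s. \<delta> * real n \<le> \<bar>real s - real n * \<mu>\<bar>} \<le> tail (iid_sum a n) x"
        by (subst (asm) measure_pmf.prob_compl[simplified]) auto
      moreover have "measure_pmf.prob (iid_sum a n) {s. \<delta> * real n \<le> \<bar>real s - real n * \<mu>\<bar>} \<le> K * real n * tail a (\<delta> * real n)"
        using K(3) y0[OF n(2)] by blast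
      moreover have "K * real n * tail a (\<delta> * real n) < \<eta>"
        using y0[OF n(2)] \<delta> by (simp add: field_simps)
      ultimately show ?thesis by linarith
    qed
    have bound: "(\<Sum>n\<le>m. tail (iid_sum a n) x * pmf p n) + (1 - \<eta>) * tail p (l * x) \<le> tail (compound a p) x"
      if x: "real m \<le> l * x" "y0 / \<delta> \<le> l * x" for x
    proof -
      have "tail (iid_sum a n) x * indicator {..m} n + (1 - \<eta>) * indicator {n. l * x < real n} n \<le> tail (iid_sum a n) x" for n
      proof (cases "l * x < real n")
        case True
        then have "y0 \<le> \<delta> * real n" using x(2) \<delta> by (simp add: field_simps) (meson less_le_trans less_imp_le mult_left_mono order_trans mult.commute)
        then show ?thesis using large[OF True] True x by simp
      next
        case False
        then show ?thesis by (auto simp: indicator_def)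
      qed
      then have "(\<integral>n. tail (iid_sum a n) x * indicator {..m} n + (1 - \<eta>) * indicator {n. l * x < real n} n \<partial>measure_pmf p)
          \<le> tail (compound a p) x"
        unfolding tail_compound
        by (intro integral_mono Bochner_Integration.integrable_add integrable_mult_right integrable_restrict_pmf
           integrable_tail_iid_sum integrable_indicator_pmf)
      also have "(\<integral>n. tail (iid_sum a n) x * indicator {..m} n + (1 - \<eta>) * indicator {n. l * x < real n} n \<partial>measure_pmf p)
        = (\<integral>n. tail (iid_sum a n) x * indicator {..m} n \<partial>measure_pmf p)
          + (1 - \<eta>) * (\<integral>n. indicator {n. l * x < real n} n \<partial>measure_pmf p)"
        by (subst Bochner_Integration.integral_add, intro integrable_restrict_pmf integrable_tail_iid_sum,
            intro integrable_mult_right integrable_indicator_pmf, simp only: integral_mult_right_zero)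
      finally show ?thesis by (simp add: truncated_sum_eq_integral tail_def)
    qed
    show ?thesis
    proof (rule liminf_geI)
      show "eventually (\<lambda>x. (\<Sum>n\<le>m. tail (iid_sum a n) x * pmf p n) / tail a x
          + (1 - \<eta>) * (tail p (l * x) / tail a x) \<le> tail (compound a p) x / tail a x) at_top"
        using eventually_ge_at_top[of "real m / l"] eventually_ge_at_top[of "y0 / \<delta> / l"]
      proof eventually_elim
        case (elim x)
        have "real m \<le> l * x" "y0 / \<delta> \<le> l * x" using elim l \<delta> by (simp_all add: divide_le_eq mult.commute mult.left_commute)
        from divide_right_mono[OF bound[OF this] less_imp_le[OF tail_pos[of x]]]
        show ?case by (simp add: add_divide_distrib)
      qed
      show "((\<lambda>x. (\<Sum>n\<le>m. tail (iid_sum a n) x * pmf p n) / tail a x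
          + (1 - \<eta>) * (tail p (l * x) / tail a x)) \<longlongrightarrow> (\<Sum>n\<le>m. real n * pmf p n) + (1 - \<eta>) * (c * l powr (-\<alpha>))) at_top"
        by (intro tendsto_add truncated_compound_tail tendsto_mult tendsto_const tail_scaling p l)
    qed
  qed
  have "liminf_ge (\<lambda>x. tail (compound a p) x / tail a x)
      ((\<integral>n. real n \<partial>measure_pmf p) + (1 - \<eta>) * (c * l powr (-\<alpha>)))" if \<eta>: "0 < \<eta>" for \<eta>
  proof (rule liminf_ge_limit)
    show "(\<lambda>m. (\<Sum>n\<le>m. real n * pmf p n) + (1 - \<eta>) * (c * l powr (-\<alpha>)))
        \<longlonglongrightarrow> (\<integral>n. real n \<partial>measure_pmf p) + (1 - \<eta>) * (c * l powr (-\<alpha>))"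
      by (intro tendsto_intros truncated_mean_tendsto int)
  qed (use fixed[OF \<eta>] in auto)
  then have "liminf_ge (\<lambda>x. tail (compound a p) x / tail a x)
      ((\<integral>n. real n \<partial>measure_pmf p) + (1 - 0) * (c * l powr (-\<alpha>)))"
    using eventually_between_0_1
    by (intro liminf_ge_limit[where F = "at_right 0" and u = "\<lambda>\<eta>. (\<integral>n. real n \<partial>measure_pmf p) + (1 - \<eta>) * (c * l powr (-\<alpha>))"]
          tendsto_intros) (auto elim: eventually_mono)
  then show ?thesis by (simp add: l_def)
qed

text \<open>The two one-sided bounds leave a gap that closes as \<open>e\<close> tends to 0: both
  \<open>((1 - e) / \<mu>) powr (-\<alpha>)\<close> and \<open>((1 + e) / \<mu>) powr (-\<alpha>)\<close> tend to \<open>\<mu> powr \<alpha>\<close>.\<close>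

theorem compound_tail:
  assumes p: "((\<lambda>x. tail p x / tail a x) \<longlongrightarrow> c) at_top" and int: "integrable (measure_pmf p) real"
  shows "((\<lambda>x. tail (compound a p) x / tail a x) \<longlongrightarrow> (\<integral>n. real n \<partial>measure_pmf p) + c * \<mu> powr \<alpha>) at_top"
proof -
  have eq: "(1 / \<mu>) powr (-\<alpha>) = \<mu> powr \<alpha>" using mean_pos by (simp add: powr_divide powr_minus)
  have "limsup_le (\<lambda>x. tail (compound a p) x / tail a x) ((\<integral>n. real n \<partial>measure_pmf p) + c * \<mu> powr \<alpha>)"
  proof (rule limsup_le_limit)
    have "((\<lambda>e. ((1 - e) / \<mu>) powr (-\<alpha>)) \<longlongrightarrow> ((1 - 0) / \<mu>) powr (-\<alpha>)) (at_right 0)"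
      using mean_pos by (intro tendsto_intros) auto
    then have "((\<lambda>e. ((1 - e) / \<mu>) powr (-\<alpha>)) \<longlongrightarrow> \<mu> powr \<alpha>) (at_right 0)"
      by (simp only: add_0_right diff_zero eq)
    then show "((\<lambda>e. (\<integral>n. real n \<partial>measure_pmf p) + c * ((1 - e) / \<mu>) powr (-\<alpha>))
        \<longlongrightarrow> (\<integral>n. real n \<partial>measure_pmf p) + c * \<mu> powr \<alpha>) (at_right 0)"
      by (intro tendsto_add[OF tendsto_const tendsto_mult[OF tendsto_const]])
    show "eventually (\<lambda>e. limsup_le (\<lambda>x. tail (compound a p) x / tail a x)
        ((\<integral>n. real n \<partial>measure_pmf p) + c * ((1 - e) / \<mu>) powr (-\<alpha>))) (at_right 0)"
      using eventually_between_0_1 by eventually_elim (auto intro!: compound_tail_upper p int)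
  qed simp
  moreover have "liminf_ge (\<lambda>x. tail (compound a p) x / tail a x) ((\<integral>n. real n \<partial>measure_pmf p) + c * \<mu> powr \<alpha>)"
  proof (rule liminf_ge_limit)
    have "((\<lambda>e. ((1 + e) / \<mu>) powr (-\<alpha>)) \<longlongrightarrow> ((1 + 0) / \<mu>) powr (-\<alpha>)) (at_right 0)"
      using mean_pos by (intro tendsto_intros) auto
    then have "((\<lambda>e. ((1 + e) / \<mu>) powr (-\<alpha>)) \<longlongrightarrow> \<mu> powr \<alpha>) (at_right 0)"
      by (simp only: add_0_right diff_zero eq)
    then show "((\<lambda>e. (\<integral>n. real n \<partial>measure_pmf p) + c * ((1 + e) / \<mu>) powr (-\<alpha>))
        \<longlongrightarrow> (\<integral>n. real n \<partial>measure_pmf p) + c * \<mu> powr \<alpha>) (at_right 0)"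
      by (intro tendsto_add[OF tendsto_const tendsto_mult[OF tendsto_const]])
    show "eventually (\<lambda>e. liminf_ge (\<lambda>x. tail (compound a p) x / tail a x)
        ((\<integral>n. real n \<partial>measure_pmf p) + c * ((1 + e) / \<mu>) powr (-\<alpha>))) (at_right 0)"
      using eventually_between_0_1 by eventually_elim (auto intro!: compound_tail_lower p int)
  qed simp
  ultimately show ?thesis by (simp add: tendsto_iff_limsup_liminf)
qed

end

section \<open>Tails of generations, uniformly in the generation\<close>

primrec generation :: "nat pmf \<Rightarrow> nat pmf \<Rightarrow> nat \<Rightarrow> nat pmf" where
  "generation a b 0 = b"
| "generation a b (Suc k) = compound a (generation a b k)"

context heavy_tailed_offspring begin

lemma nn_mean_generation:
  assumes "(\<integral>\<^sup>+n. ennreal (real n) \<partial>measure_pmf b) = ennreal m" "0 \<le> m"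
  shows "(\<integral>\<^sup>+n. ennreal (real n) \<partial>measure_pmf (generation a b k)) = ennreal (m * \<mu> ^ k)"
proof (induction k)
  case (Suc k)
  then show ?case using nn_mean_compound[of "generation a b k"] mean_pos assms(2)
    by (simp flip: ennreal_mult add: mult_ac)
qed (simp add: assms)

lemma mean_from_nn_mean:
  assumes "(\<integral>\<^sup>+n. ennreal (real n) \<partial>measure_pmf p) = ennreal m" "0 \<le> m"
  shows "integrable (measure_pmf p) real" "(\<integral>n. real n \<partial>measure_pmf p) = m"
proof -
  show int: "integrable (measure_pmf p) real"
    by (rule integrableI_nonneg) (auto simp: assms)
  show "(\<integral>n. real n \<partial>measure_pmf p) = m"
    using nn_integral_eq_integral[OF int] assms by (simp add: Bochner_Integration.integral_nonneg)
qed

text \<open>The recursion that \<open>compound_tail\<close> imposes on the limits of \<open>P(C\<^sub>k > x) / g x\<close> when \<open>m\<close> is the mean and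
  \<open>c\<close> the tail constant of \<open>C\<^sub>0\<close>.\<close>

primrec tail_coeff :: "real \<Rightarrow> real \<Rightarrow> nat \<Rightarrow> real" where
  "tail_coeff m c 0 = c"
| "tail_coeff m c (Suc k) = m * \<mu> ^ k + tail_coeff m c k * \<mu> powr \<alpha>"

lemma generation_tail:
  assumes m: "(\<integral>\<^sup>+n. ennreal (real n) \<partial>measure_pmf b) = ennreal m" "0 \<le> m"
    and b: "((\<lambda>x. tail b x / tail a x) \<longlongrightarrow> c) at_top"
  shows "((\<lambda>x. tail (generation a b k) x / tail a x) \<longlongrightarrow> tail_coeff m c k) at_top"
proof (induction k)
  case (Suc k)
  have "0 \<le> m * \<mu> ^ k" using m(2) mean_pos by simp
  from mean_from_nn_mean[OF nn_mean_generation[OF m] this]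
  show ?case using compound_tail[OF Suc] by simp
qed (simp add: b)

text \<open>By \<open>huber_compound\<close>, the bound at \<open>x\<close> for generation \<open>k + 1\<close> follows from the bound at \<open>x / \<mu> \<ge> x\<close> for
  generation \<open>k\<close>; hence the same threshold \<open>x0\<close> serves all generations. Passing from \<open>x / \<mu>\<close> to \<open>x\<close>
  gains a factor \<open>\<mu> < \<rho>\<close>, as \<open>g(x / \<mu>) / g x \<rightarrow> \<mu>\<^sup>\<alpha> < \<mu>\<close>, and the gap \<open>\<rho> - \<mu>\<close> absorbs the
  new term of order \<open>\<mu>\<^sup>k\<close>.\<close>

lemma generation_huber_bound:
  assumes m: "(\<integral>\<^sup>+n. ennreal (real n) \<partial>measure_pmf b) = ennreal m" "0 \<le> m"
    and b: "dominated b" and \<mu>: "\<mu> < 1" and \<rho>: "\<mu> < \<rho>"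
  obtains K x0 where "0 < K" "0 < x0"
    "\<And>k x. x0 \<le> x \<Longrightarrow> (\<integral>\<^sup>+n. ennreal (huber (real n / x)) \<partial>measure_pmf (generation a b k)) \<le> ennreal (K * \<rho> ^ k * tail a x)"
proof -
  obtain K1 x1 where 1: "0 < K1" "0 < x1"
    "\<And>x. x1 \<le> x \<Longrightarrow> (\<integral>\<^sup>+n. ennreal (huber (real n / x)) \<partial>measure_pmf b) \<le> ennreal (K1 * tail a x)"
    by (rule huber_moment_bound[OF b]) blast
  obtain K2 x2 where 2: "0 < K2" "0 < x2" "\<And>x. x2 \<le> x \<Longrightarrow> deviation x \<le> ennreal (K2 * tail a x)"
    by (rule deviation_bound) blast
  have "\<mu> powr \<alpha> < \<mu> powr 1" using index_gt_1 mean_pos \<mu> by (intro powr_less_mono') auto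
  then have lt: "(1 / \<mu>) powr (-\<alpha>) < \<mu>" using mean_pos by (simp add: powr_divide powr_minus)
  have "eventually (\<lambda>x. tail a (1 / \<mu> * x) / tail a x < \<mu>) at_top"
    using mean_pos by (intro order_tendstoD(2)[OF tail_ratio lt]) auto
  then obtain x3 where x3: "\<And>x. x3 \<le> x \<Longrightarrow> tail a (1 / \<mu> * x) / tail a x < \<mu>"
    by (auto simp: eventually_at_top_linorder)
  have shrink: "tail a (x / \<mu>) \<le> \<mu> * tail a x" if "x3 \<le> x" for x
    using x3[OF that] tail_pos[of x] by (simp add: field_simps)
  define x0 where "x0 = max (max x1 x2) x3"
  define K where "K = max K1 (2 * K2 * m / (\<rho> - \<mu>))"
  have K: "0 < K" using 1 by (auto simp: K_def)
  have x0: "0 < x0" using 1 by (auto simp: x0_def)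
  have "2 * K2 * m / (\<rho> - \<mu>) \<le> K" by (simp add: K_def)
  then have Km: "2 * K2 * m \<le> K * (\<rho> - \<mu>)" using \<rho> by (simp add: divide_le_eq)
  have "(\<integral>\<^sup>+n. ennreal (huber (real n / x)) \<partial>measure_pmf (generation a b k)) \<le> ennreal (K * \<rho> ^ k * tail a x)"
    if "x0 \<le> x" for k x
    using that
  proof (induction k arbitrary: x)
    case 0
    have "(\<integral>\<^sup>+n. ennreal (huber (real n / x)) \<partial>measure_pmf b) \<le> ennreal (K1 * tail a x)"
      using 0 1 by (auto simp: x0_def)
    also have "\<dots> \<le> ennreal (K * tail a x)"
      by (intro ennreal_leI mult_right_mono) (auto simp: K_def)
    finally show ?case by simp
  next
    case (Suc k)
    have xpos: "0 < x" using Suc.prems x0 by simp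
    have "x0 * \<mu> \<le> x0 * 1" using x0 \<mu> by (intro mult_left_mono) auto
    then have ge: "x0 \<le> x / \<mu>" using Suc.prems mean_pos by (simp add: field_simps)
    have dev: "2 * deviation x * ennreal (m * \<mu> ^ k) \<le> ennreal (2 * K2 * m * \<mu> ^ k * tail a x)"
    proof -
      have "2 * deviation x * ennreal (m * \<mu> ^ k) \<le> 2 * ennreal (K2 * tail a x) * ennreal (m * \<mu> ^ k)"
        using 2 Suc.prems by (intro mult_right_mono mult_left_mono) (auto simp: x0_def)
      also have "\<dots> = ennreal (2 * K2 * m * \<mu> ^ k * tail a x)"
        using 2 m mean_pos by (simp add: ennreal_mult mult_ac)
      finally show ?thesis .
    qed
    have "K * \<rho> ^ k * tail a (x / \<mu>) + 2 * K2 * m * \<mu> ^ k * tail a x \<le> K * \<rho> ^ Suc k * tail a x"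
    proof -
      have "K * \<rho> ^ k * tail a (x / \<mu>) \<le> K * \<rho> ^ k * (\<mu> * tail a x)"
        using K \<rho> mean_pos Suc.prems by (intro mult_left_mono shrink) (auto simp: x0_def)
      moreover have "2 * K2 * m * \<mu> ^ k * tail a x \<le> 2 * K2 * m * \<rho> ^ k * tail a x"
        using 2 m mean_pos \<rho> by (intro mult_right_mono mult_left_mono power_mono) auto
      moreover have "2 * K2 * m * (\<rho> ^ k * tail a x) \<le> K * (\<rho> - \<mu>) * (\<rho> ^ k * tail a x)"
        using Km \<rho> mean_pos by (intro mult_right_mono) auto
      ultimately show ?thesis by (simp add: algebra_simps)
    qed
    note sum = this
    have "(\<integral>\<^sup>+n. ennreal (huber (real n / x)) \<partial>measure_pmf (generation a b (Suc k)))
      \<le> (\<integral>\<^sup>+n. ennreal (huber (real n / (x / \<mu>))) \<partial>measure_pmf (generation a b k)) + 2 * deviation x * ennreal (m * \<mu> ^ k)"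
      using huber_compound[OF xpos, of "generation a b k"] nn_mean_generation[OF m] by simp
    also have "\<dots> \<le> ennreal (K * \<rho> ^ k * tail a (x / \<mu>)) + ennreal (2 * K2 * m * \<mu> ^ k * tail a x)"
      by (intro add_mono Suc.IH ge dev)
    also have "\<dots> = ennreal (K * \<rho> ^ k * tail a (x / \<mu>) + 2 * K2 * m * \<mu> ^ k * tail a x)"
      using K \<rho> mean_pos 2 m by (intro ennreal_plus[symmetric]) auto
    also have "\<dots> \<le> ennreal (K * \<rho> ^ Suc k * tail a x)" by (intro ennreal_leI sum)
    finally show ?case .
  qed
  then show thesis using that K x0 by blast
qed

text \<open>Markov's inequality at the level \<open>q \<le> 1\<close>, where the Huber function is \<open>q\<^sup>2\<close>. The bound is stated at a
  variable fraction \<open>q\<close> of \<open>x\<close>, with the threshold on \<open>x\<close> only: the union bound over all generations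
  uses arbitrarily small fractions.\<close>

lemma generation_tail_bound:
  assumes m: "(\<integral>\<^sup>+n. ennreal (real n) \<partial>measure_pmf b) = ennreal m" "0 \<le> m"
    and b: "dominated b" and \<mu>: "\<mu> < 1" and \<rho>: "\<mu> < \<rho>"
  obtains K x0 where "0 < K" "0 < x0"
    "\<And>k x q. x0 \<le> x \<Longrightarrow> 0 < q \<Longrightarrow> q \<le> 1 \<Longrightarrow> tail (generation a b k) (q * x) \<le> K * \<rho> ^ k / q\<^sup>2 * tail a x"
proof -
  obtain K x0 where K: "0 < K" "0 < x0"
    "\<And>k x. x0 \<le> x \<Longrightarrow> (\<integral>\<^sup>+n. ennreal (huber (real n / x)) \<partial>measure_pmf (generation a b k)) \<le> ennreal (K * \<rho> ^ k * tail a x)"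
    by (rule generation_huber_bound[OF assms]) blast
  have "tail (generation a b k) (q * x) \<le> K * \<rho> ^ k / q\<^sup>2 * tail a x" if x: "x0 \<le> x" and q: "0 < q" "q \<le> 1" for k x q
  proof -
    have "ennreal (q\<^sup>2) * ennreal (tail (generation a b k) (q * x))
        = (\<integral>\<^sup>+n. ennreal (q\<^sup>2) * indicator {n. q * x < real n} n \<partial>measure_pmf (generation a b k))"
      by (subst nn_integral_cmult) (auto simp: nn_integral_pmf_indicator)
    also have "\<dots> \<le> (\<integral>\<^sup>+n. ennreal (huber (real n / x)) \<partial>measure_pmf (generation a b k))"
    proof (intro nn_integral_mono)
      fix n
      have "q\<^sup>2 \<le> huber (real n / x)" if "q * x < real n"
        using q that x K(2) by (intro huber_ge_level) (auto simp: field_simps)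
      then show "ennreal (q\<^sup>2) * indicator {n. q * x < real n} n \<le> ennreal (huber (real n / x))"
        by (auto simp: indicator_def intro: ennreal_leI)
    qed
    also have "\<dots> \<le> ennreal (K * \<rho> ^ k * tail a x)" using K(3) x by blast
    finally have "q\<^sup>2 * tail (generation a b k) (q * x) \<le> K * \<rho> ^ k * tail a x"
      using K \<rho> mean_pos by (simp flip: ennreal_mult)
    then show ?thesis using q by (simp add: field_simps)
  qed
  then show thesis using that K by blast
qed

end

section \<open>Sum and supremum of independent generations\<close>

text \<open>Contrapositive of the union bound: if the first \<open>n\<close> terms sum to at most \<open>y\<close> and each later term stays
  below its share of \<open>z\<close>, the whole series is at most \<open>y + z\<close>.\<close>

lemma suminf_ennreal_le_split:
  fixes f :: "nat \<Rightarrow> nat" and q :: "nat \<Rightarrow> real"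
  assumes "(\<Sum>k<n. real (f k)) \<le> y" "\<And>k. real (f (n + k)) \<le> q k * z" "q sums 1" "\<And>k. 0 \<le> q k" "0 \<le> z"
  shows "(\<Sum>k. of_nat (f k) :: ennreal) \<le> ennreal (y + z)"
proof -
  have y: "0 \<le> y" using assms(1) by (rule order_trans[rotated]) (simp add: sum_nonneg)
  have "(\<Sum>k. of_nat (f k) :: ennreal) = (\<Sum>k. of_nat (f (k + n))) + (\<Sum>k<n. of_nat (f k))"
    by (rule suminf_offset) simp
  also have "\<dots> \<le> (\<Sum>k. ennreal (q k * z)) + ennreal y"
  proof (rule add_mono)
    show "(\<Sum>k. of_nat (f (k + n)) :: ennreal) \<le> (\<Sum>k. ennreal (q k * z))"
      using assms(2) by (intro suminf_le summableI) (auto simp: ennreal_of_nat_eq_real_of_nat add.commute intro: ennreal_leI)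
    have "(\<Sum>k<n. of_nat (f k) :: ennreal) = ennreal (\<Sum>k<n. real (f k))"
      by (simp add: ennreal_of_nat_eq_real_of_nat sum_ennreal del: of_nat_sum)
    also have "\<dots> \<le> ennreal y" using assms(1) by (rule ennreal_leI)
    finally show "(\<Sum>k<n. of_nat (f k) :: ennreal) \<le> ennreal y" .
  qed
  also have "(\<Sum>k. ennreal (q k * z)) = ennreal (1 * z)"
    using assms(3-5) by (intro suminf_ennreal_eq sums_mult2) auto
  also have "ennreal (1 * z) + ennreal y = ennreal (y + z)"
    using y assms(5) by (simp flip: ennreal_plus add: add.commute)
  finally show ?thesis .
qed

context heavy_tailed_offspring begin

lemma tail_coeff_nonneg: "0 \<le> m \<Longrightarrow> 0 \<le> c \<Longrightarrow> 0 \<le> tail_coeff m c k"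
  using mean_pos by (induction k) auto

lemma tail_coeff_bound:
  assumes m: "(\<integral>\<^sup>+n. ennreal (real n) \<partial>measure_pmf b) = ennreal m" "0 \<le> m"
    and b: "((\<lambda>x. tail b x / tail a x) \<longlongrightarrow> c) at_top" and \<mu>: "\<mu> < 1" and \<rho>: "\<mu> < \<rho>"
  obtains K where "\<And>k. tail_coeff m c k \<le> K * \<rho> ^ k"
proof -
  obtain K x0 where K: "0 < K" "0 < x0"
    "\<And>k x q. x0 \<le> x \<Longrightarrow> 0 < q \<Longrightarrow> q \<le> 1 \<Longrightarrow> tail (generation a b k) (q * x) \<le> K * \<rho> ^ k / q\<^sup>2 * tail a x"
    by (rule generation_tail_bound[OF m dominated_if_tendsto[OF b] \<mu> \<rho>]) blast
  have "tail_coeff m c k \<le> K * \<rho> ^ k" for k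
  proof (rule tendsto_upperbound[OF generation_tail[OF m b]])
    show "eventually (\<lambda>x. tail (generation a b k) x / tail a x \<le> K * \<rho> ^ k) at_top"
      using eventually_ge_at_top[of x0]
    proof eventually_elim
      case (elim x)
      show ?case using K(3)[of x 1 k] elim tail_pos[of x] by (simp add: divide_le_eq)
    qed
  qed simp
  then show thesis using that by blast
qed

lemma summable_tail_coeff:
  assumes m: "(\<integral>\<^sup>+n. ennreal (real n) \<partial>measure_pmf b) = ennreal m" "0 \<le> m"
    and b: "((\<lambda>x. tail b x / tail a x) \<longlongrightarrow> c) at_top" "0 \<le> c" and \<mu>: "\<mu> < 1"
  shows "summable (tail_coeff m c)"
proof -
  obtain \<rho> where \<rho>: "\<mu> < \<rho>" "\<rho> < 1" using dense[OF \<mu>] by blast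
  obtain K where K: "\<And>k. tail_coeff m c k \<le> K * \<rho> ^ k" by (rule tail_coeff_bound[OF m b(1) \<mu> \<rho>(1)]) blast
  show ?thesis
    by (rule summable_comparison_test[where g = "\<lambda>k. K * \<rho> ^ k"])
       (use K tail_coeff_nonneg[OF m(2) b(2)] \<rho> mean_pos in \<open>auto intro!: summable_mult summable_geometric\<close>)
qed

end

locale independent_generations = heavy_tailed_offspring a \<mu> \<alpha> + prob_space M
  for a \<mu> \<alpha> and M :: "'m measure" +
  fixes b :: "nat pmf" and m c :: real and C :: "nat \<Rightarrow> 'm \<Rightarrow> nat"
  assumes mean_initial: "(\<integral>\<^sup>+n. ennreal (real n) \<partial>measure_pmf b) = ennreal m" "0 \<le> m"
    and tail_initial: "((\<lambda>x. tail b x / tail a x) \<longlongrightarrow> c) at_top" "0 \<le> c"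
    and subcritical: "\<mu> < 1"
    and indep: "indep_vars (\<lambda>_. count_space UNIV) C UNIV"
    and law: "\<And>k. distr M (count_space UNIV) (C k) = measure_pmf (generation a b k)"
begin

lemma C_measurable [measurable]: "C k \<in> measurable M (count_space UNIV)"
  using indep by (simp add: indep_vars_def)

lemma prob_C: "\<P>(\<omega> in M. x < real (C k \<omega>)) = tail (generation a b k) x"
proof -
  have "tail (generation a b k) x = measure (distr M (count_space UNIV) (C k)) {n. x < real n}"
    by (simp add: law tail_def)
  also have "\<dots> = \<P>(\<omega> in M. x < real (C k \<omega>))"
    by (subst measure_distr) (auto intro!: arg_cong[where f = prob])
  finally show ?thesis ..
qed

lemma indep_real: "indep_vars (\<lambda>_. borel) (\<lambda>k \<omega>. real (C k \<omega>)) UNIV"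
  using indep_vars_compose2[OF indep, of "\<lambda>_. real" "\<lambda>_. borel"] by simp

lemma prob_two_exceed:
  assumes "j \<noteq> k"
  shows "\<P>(\<omega> in M. x < real (C j \<omega>) \<and> x < real (C k \<omega>)) = tail (generation a b j) x * tail (generation a b k) x"
proof -
  have "prob (\<Inter>i\<in>{j, k}. C i -` {n. x < real n} \<inter> space M) = (\<Prod>i\<in>{j, k}. prob (C i -` {n. x < real n} \<inter> space M))"
    by (rule indep_varsD[OF indep]) auto
  moreover have "(\<Inter>i\<in>{j, k}. C i -` {n. x < real n} \<inter> space M) = {\<omega>\<in>space M. x < real (C j \<omega>) \<and> x < real (C k \<omega>)}"
    by auto
  moreover have "C i -` {n. x < real n} \<inter> space M = {\<omega>\<in>space M. x < real (C i \<omega>)}" for i by auto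
  ultimately show ?thesis using assms by (simp add: prob_C)
qed

lemma partial_sum_tail:
  "((\<lambda>x. \<P>(\<omega> in M. x < (\<Sum>k<n. real (C k \<omega>))) / tail a x) \<longlongrightarrow> (\<Sum>k<n. tail_coeff m c k)) at_top"
proof (induction n)
  case 0
  have "eventually (\<lambda>x. \<P>(\<omega> in M. x < (\<Sum>k<0. real (C k \<omega>))) / tail a x = 0) at_top"
    using eventually_ge_at_top[of 0] by eventually_elim auto
  then show ?case by (simp add: tendsto_eventually)
next
  case (Suc n)
  have iv: "indep_var borel (\<lambda>\<omega>. real (C n \<omega>)) borel (\<lambda>\<omega>. \<Sum>k<n. real (C k \<omega>))"
    by (rule indep_vars_sum[OF _ _ indep_vars_subset[OF indep_real]]) auto
  have "((\<lambda>x. \<P>(\<omega> in M. x < (\<Sum>k<n. real (C k \<omega>)) + real (C n \<omega>)) / tail a x)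
      \<longlongrightarrow> (\<Sum>k<n. tail_coeff m c k) + tail_coeff m c n) at_top"
  proof (rule tail_sum_indep)
    fix x
    have "prob ((\<lambda>\<omega>. (real (C n \<omega>), \<Sum>k<n. real (C k \<omega>))) -` ({x<..} \<times> {x<..}) \<inter> space M)
      = prob ((\<lambda>\<omega>. real (C n \<omega>)) -` {x<..} \<inter> space M) * prob ((\<lambda>\<omega>. \<Sum>k<n. real (C k \<omega>)) -` {x<..} \<inter> space M)"
      by (rule indep_varD[OF iv]) auto
    moreover have "(\<lambda>\<omega>. (real (C n \<omega>), \<Sum>k<n. real (C k \<omega>))) -` ({x<..} \<times> {x<..}) \<inter> space M
        = {\<omega>\<in>space M. x < (\<Sum>k<n. real (C k \<omega>)) \<and> x < real (C n \<omega>)}" by auto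
    moreover have "(\<lambda>\<omega>. real (C n \<omega>)) -` {x<..} \<inter> space M = {\<omega>\<in>space M. x < real (C n \<omega>)}" by auto
    moreover have "(\<lambda>\<omega>. \<Sum>k<n. real (C k \<omega>)) -` {x<..} \<inter> space M = {\<omega>\<in>space M. x < (\<Sum>k<n. real (C k \<omega>))}" by auto
    ultimately show "\<P>(\<omega> in M. x < (\<Sum>k<n. real (C k \<omega>)) \<and> x < real (C n \<omega>))
       = \<P>(\<omega> in M. x < (\<Sum>k<n. real (C k \<omega>))) * \<P>(\<omega> in M. x < real (C n \<omega>))"
      by (simp add: mult.commute)
    show "((\<lambda>x. \<P>(\<omega> in M. x < real (C n \<omega>)) / tail a x) \<longlongrightarrow> tail_coeff m c n) at_top"
      unfolding prob_C by (rule generation_tail[OF mean_initial tail_initial(1)])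
  qed (auto intro: sum_nonneg prob_space_axioms Suc)
  then show ?case by simp
qed

text \<open>A Bonferroni inequality; by independence the correction terms are products of two tails.\<close>

lemma partial_max_lower:
  "(\<Sum>k<n. tail (generation a b k) x) - (\<Sum>k<n. \<Sum>j<k. tail (generation a b j) x * tail (generation a b k) x)
    \<le> \<P>(\<omega> in M. \<exists>k<n. x < real (C k \<omega>))"
proof (induction n)
  case (Suc n)
  let ?E = "{\<omega>\<in>space M. \<exists>k<n. x < real (C k \<omega>)}" and ?F = "{\<omega>\<in>space M. x < real (C n \<omega>)}"
  have "prob (?E \<inter> ?F) \<le> prob (\<Union>j\<in>{..<n}. {\<omega>\<in>space M. x < real (C j \<omega>) \<and> x < real (C n \<omega>)})"
    by (rule finite_measure_mono) auto
  also have "\<dots> \<le> (\<Sum>j<n. \<P>(\<omega> in M. x < real (C j \<omega>) \<and> x < real (C n \<omega>)))"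
    by (rule finite_measure_subadditive_finite) auto
  also have "\<dots> = (\<Sum>j<n. tail (generation a b j) x * tail (generation a b n) x)"
    by (intro sum.cong prob_two_exceed) auto
  finally have EF: "prob (?E \<inter> ?F) \<le> (\<Sum>j<n. tail (generation a b j) x * tail (generation a b n) x)" .
  have "\<P>(\<omega> in M. \<exists>k<Suc n. x < real (C k \<omega>)) = prob (?E \<union> ?F)"
    by (intro arg_cong[where f = prob]) (auto simp: less_Suc_eq)
  also have "\<dots> = prob ?E + prob ?F - prob (?E \<inter> ?F)"
    by (rule measure_Un3) (auto simp: fmeasurable_eq_sets)
  finally show ?case using Suc EF by (simp add: prob_C)
qed simp

lemma partial_max_liminf:
  assumes "\<And>x. 0 \<le> x \<Longrightarrow> \<P>(\<omega> in M. \<exists>k<n. x < real (C k \<omega>)) \<le> F x"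
  shows "liminf_ge (\<lambda>x. F x / tail a x) (\<Sum>k<n. tail_coeff m c k)"
proof (rule liminf_geI)
  note gt = generation_tail[OF mean_initial tail_initial(1)]
  have "((\<lambda>x. (\<Sum>k<n. tail (generation a b k) x / tail a x)
      - (\<Sum>k<n. \<Sum>j<k. tail (generation a b j) x * (tail (generation a b k) x / tail a x)))
    \<longlongrightarrow> (\<Sum>k<n. tail_coeff m c k) - (\<Sum>k<n. \<Sum>j<k. 0 * tail_coeff m c k)) at_top"
    by (intro tendsto_intros gt tail_tendsto_0)
  then show "((\<lambda>x. ((\<Sum>k<n. tail (generation a b k) x) - (\<Sum>k<n. \<Sum>j<k. tail (generation a b j) x * tail (generation a b k) x)) / tail a x)
    \<longlongrightarrow> (\<Sum>k<n. tail_coeff m c k)) at_top"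
    by (simp add: diff_divide_distrib sum_divide_distrib)
  show "eventually (\<lambda>x. ((\<Sum>k<n. tail (generation a b k) x) - (\<Sum>k<n. \<Sum>j<k. tail (generation a b j) x * tail (generation a b k) x)) / tail a x
      \<le> F x / tail a x) at_top"
    using eventually_ge_at_top[of 0]
  proof eventually_elim
    case (elim x)
    show ?case using partial_max_lower[of x n] assms[OF elim]
      by (intro divide_right_mono less_imp_le[OF tail_pos]) linarith
  qed
qed

lemma summable_coeff: "summable (tail_coeff m c)"
  by (rule summable_tail_coeff[OF mean_initial tail_initial subcritical])

text \<open>The series exceeds \<open>x\<close> only if the first \<open>n\<close> terms exceed \<open>(1 - e) x\<close> or some later term exceeds its
  share \<open>q k\<close> of \<open>e x\<close>. The latter has probability at most \<open>K' w\<^sup>3\<^sup>n g(e x)\<close>. Let \<open>n\<close> tend to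
  infinity, then \<open>e\<close> to 0.\<close>

lemma sum_tail_limsup:
  "limsup_le (\<lambda>x. \<P>(\<omega> in M. ennreal x < (\<Sum>k. of_nat (C k \<omega>))) / tail a x) (\<Sum>k. tail_coeff m c k)"
proof -
  define H where "H x = \<P>(\<omega> in M. ennreal x < (\<Sum>k. of_nat (C k \<omega>)))" for x
  \<comment> \<open>Dividing by \<open>(q k)\<^sup>2\<close> costs a factor \<open>w\<close> to the power \<open>-2 k\<close>, so the decay rate of the tail bounds has to be \<open>w\<^sup>3\<close>, which must exceed \<open>\<mu>\<close>.\<close>
  define w where "w = 1 - (1 - \<mu>) / 4"
  have w: "0 < w" "w < 1" using mean_pos subcritical by (auto simp: w_def field_simps)
  have "1 + real 3 * (- ((1 - \<mu>) / 4)) \<le> (1 + (- ((1 - \<mu>) / 4))) ^ 3"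
    using mean_pos subcritical by (intro Bernoulli_inequality) auto
  moreover have "\<mu> < 1 + real 3 * (- ((1 - \<mu>) / 4))" using subcritical by (simp add: field_simps)
  ultimately have \<rho>: "\<mu> < w ^ 3" by (simp add: w_def)
  obtain K x0 where K: "0 < K" "0 < x0"
    "\<And>k x q. x0 \<le> x \<Longrightarrow> 0 < q \<Longrightarrow> q \<le> 1 \<Longrightarrow> tail (generation a b k) (q * x) \<le> K * (w ^ 3) ^ k / q\<^sup>2 * tail a x"
    by (rule generation_tail_bound[OF mean_initial dominated_if_tendsto[OF tail_initial(1)] subcritical \<rho>]) blast
  define q where "q k = (1 - w) * w ^ k" for k
  have q: "0 < q k" "q k \<le> 1" for k
    using w by (auto simp: q_def intro!: mult_le_one power_le_one)
  have "(\<lambda>k. (1 - w) * w ^ k) sums ((1 - w) * (1 / (1 - w)))"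
    using w by (intro sums_mult geometric_sums) auto
  then have q_sums: "q sums 1" using w by (simp add: q_def[abs_def])
  define K' where "K' = K / (1 - w) ^ 3"
  have remainder: "summable (\<lambda>k. tail (generation a b (n + k)) (q k * y))"
    "(\<Sum>k. tail (generation a b (n + k)) (q k * y)) \<le> K' * (w ^ 3) ^ n * tail a y" if y: "x0 \<le> y" for n y
  proof -
    have le: "tail (generation a b (n + k)) (q k * y) \<le> K * (w ^ 3) ^ n / (1 - w)\<^sup>2 * tail a y * w ^ k" for k
    proof -
      have "tail (generation a b (n + k)) (q k * y) \<le> K * (w ^ 3) ^ (n + k) / (q k)\<^sup>2 * tail a y"
        using K(3) y q by blast
      also have "(w ^ 3) ^ (n + k) = (w ^ 3) ^ n * (w ^ k) ^ 2 * w ^ k"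
        by (simp add: power_add flip: power_mult) (simp add: power_add[symmetric] mult_ac)
      also have "K * ((w ^ 3) ^ n * (w ^ k) ^ 2 * w ^ k) / (q k)\<^sup>2 = K * (w ^ 3) ^ n / (1 - w)\<^sup>2 * w ^ k"
      proof -
        have "K * (R * v\<^sup>2 * v) / ((1 - w) * v)\<^sup>2 = K * R / (1 - w)\<^sup>2 * v" if "v \<noteq> 0" for R v
          using that w by (simp add: power2_eq_square divide_simps)
        then show ?thesis using w by (simp add: q_def)
      qed
      finally show ?thesis by (simp add: mult_ac)
    qed
    have sums: "(\<lambda>k. K * (w ^ 3) ^ n / (1 - w)\<^sup>2 * tail a y * w ^ k) sums (K * (w ^ 3) ^ n / (1 - w)\<^sup>2 * tail a y * (1 / (1 - w)))"
      using w by (intro sums_mult geometric_sums) auto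
    show summ: "summable (\<lambda>k. tail (generation a b (n + k)) (q k * y))"
      by (rule summable_comparison_test[OF _ sums_summable[OF sums]]) (use le in auto)
    have "(\<Sum>k. tail (generation a b (n + k)) (q k * y)) \<le> K * (w ^ 3) ^ n / (1 - w)\<^sup>2 * tail a y * (1 / (1 - w))"
      unfolding sums_unique[OF sums] by (intro suminf_le le summ sums_summable[OF sums])
    then show "(\<Sum>k. tail (generation a b (n + k)) (q k * y)) \<le> K' * (w ^ 3) ^ n * tail a y"
      using w by (simp add: K'_def power3_eq_cube power2_eq_square mult_ac)
  qed
  have bound: "H x \<le> \<P>(\<omega> in M. (1 - e) * x < (\<Sum>k<n. real (C k \<omega>))) + K' * (w ^ 3) ^ n * tail a (e * x)"
    if e: "0 < e" "e < 1" and x: "x0 / e \<le> x" for e n x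
  proof -
    have ex: "x0 \<le> e * x" using x e by (simp add: field_simps)
    then have ex0: "0 < e * x" using K(2) by linarith
    let ?A = "{\<omega>\<in>space M. (1 - e) * x < (\<Sum>k<n. real (C k \<omega>))}"
    let ?B = "\<lambda>k. {\<omega>\<in>space M. q k * (e * x) < real (C (n + k) \<omega>)}"
    have "H x \<le> prob (?A \<union> (\<Union>k. ?B k))"
      unfolding H_def
    proof (rule finite_measure_mono)
      show "{\<omega>\<in>space M. ennreal x < (\<Sum>k. of_nat (C k \<omega>))} \<subseteq> ?A \<union> (\<Union>k. ?B k)"
      proof (rule subsetI, rule ccontr)
        fix \<omega> assume \<omega>: "\<omega> \<in> {\<omega>\<in>space M. ennreal x < (\<Sum>k. of_nat (C k \<omega>))}" "\<omega> \<notin> ?A \<union> (\<Union>k. ?B k)"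
        have "(\<Sum>k. of_nat (C k \<omega>) :: ennreal) \<le> ennreal ((1 - e) * x + e * x)"
          using \<omega> q ex0 by (intro suminf_ennreal_le_split[OF _ _ q_sums, where n = n]) (auto simp: not_less less_imp_le)
        moreover have "(1 - e) * x + e * x = x" by (simp add: algebra_simps)
        ultimately have "\<not> ennreal x < (\<Sum>k. of_nat (C k \<omega>))" by (simp add: not_less)
        then show False using \<omega>(1) by blast
      qed
    qed auto
    also have "\<dots> \<le> prob ?A + prob (\<Union>k. ?B k)" by (intro measure_Un_le) auto
    also have "prob (\<Union>k. ?B k) \<le> (\<Sum>k. prob (?B k))"
      using remainder(1)[OF ex] by (intro finite_measure_subadditive_countably) (auto simp: prob_C)
    also have "\<dots> \<le> K' * (w ^ 3) ^ n * tail a (e * x)"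
      using remainder(2)[OF ex, of n] by (simp add: prob_C)
    finally show ?thesis by simp
  qed
  have "limsup_le (\<lambda>x. H x / tail a x) ((\<Sum>k. tail_coeff m c k) * (1 - e) powr (-\<alpha>))" if e: "0 < e" "e < 1" for e
  proof (rule limsup_le_limit)
    have "w ^ 3 < 1" using w by (simp add: power_less_one_iff)
    then have "(\<lambda>n. (\<Sum>k<n. tail_coeff m c k) * (1 - e) powr (-\<alpha>) + K' * (w ^ 3) ^ n * e powr (-\<alpha>))
        \<longlonglongrightarrow> (\<Sum>k. tail_coeff m c k) * (1 - e) powr (-\<alpha>) + K' * 0 * e powr (-\<alpha>)"
      using w by (intro tendsto_add tendsto_mult tendsto_const summable_LIMSEQ summable_coeff LIMSEQ_realpow_zero) auto
    then show "(\<lambda>n. (\<Sum>k<n. tail_coeff m c k) * (1 - e) powr (-\<alpha>) + K' * (w ^ 3) ^ n * e powr (-\<alpha>))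
        \<longlonglongrightarrow> (\<Sum>k. tail_coeff m c k) * (1 - e) powr (-\<alpha>)" by simp
    show "eventually (\<lambda>n. limsup_le (\<lambda>x. H x / tail a x)
        ((\<Sum>k<n. tail_coeff m c k) * (1 - e) powr (-\<alpha>) + K' * (w ^ 3) ^ n * e powr (-\<alpha>))) sequentially"
    proof (rule always_eventually, rule allI)
      fix n
      show "limsup_le (\<lambda>x. H x / tail a x)
        ((\<Sum>k<n. tail_coeff m c k) * (1 - e) powr (-\<alpha>) + K' * (w ^ 3) ^ n * e powr (-\<alpha>))"
      proof (rule limsup_leI)
        show "((\<lambda>x. \<P>(\<omega> in M. (1 - e) * x < (\<Sum>k<n. real (C k \<omega>))) / tail a x + K' * (w ^ 3) ^ n * (tail a (e * x) / tail a x))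
            \<longlongrightarrow> (\<Sum>k<n. tail_coeff m c k) * (1 - e) powr (-\<alpha>) + K' * (w ^ 3) ^ n * e powr (-\<alpha>)) at_top"
          using e by (intro tendsto_add tendsto_mult tendsto_const tail_ratio tail_scaling[OF partial_sum_tail]) auto
        show "eventually (\<lambda>x. H x / tail a x \<le>
            \<P>(\<omega> in M. (1 - e) * x < (\<Sum>k<n. real (C k \<omega>))) / tail a x + K' * (w ^ 3) ^ n * (tail a (e * x) / tail a x)) at_top"
          using eventually_ge_at_top[of "x0 / e"]
        proof eventually_elim
          case (elim x)
          show ?case using divide_right_mono[OF bound[OF e elim, of n] less_imp_le[OF tail_pos[of x]]]
            by (simp add: add_divide_distrib)
        qed
      qed
    qed
  qed simp
  then have "eventually (\<lambda>e. limsup_le (\<lambda>x. H x / tail a x) ((\<Sum>k. tail_coeff m c k) * (1 - e) powr (-\<alpha>))) (at_right 0)"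
    by (intro eventually_mono[OF eventually_between_0_1]) auto
  moreover have "((\<lambda>e. (\<Sum>k. tail_coeff m c k) * (1 - e) powr (-\<alpha>)) \<longlongrightarrow> (\<Sum>k. tail_coeff m c k)) (at_right 0)"
    by (auto intro!: tendsto_eq_intros)
  ultimately show ?thesis unfolding H_def by (intro limsup_le_limit) auto
qed

theorem sum_and_sup_tail:
  "((\<lambda>x. \<P>(\<omega> in M. ennreal x < (\<Sum>k. of_nat (C k \<omega>))) / tail a x) \<longlongrightarrow> (\<Sum>k. tail_coeff m c k)) at_top"
  "((\<lambda>x. \<P>(\<omega> in M. ennreal x < (SUP k. of_nat (C k \<omega>))) / tail a x) \<longlongrightarrow> (\<Sum>k. tail_coeff m c k)) at_top"
proof -
  define S where "S x = \<P>(\<omega> in M. ennreal x < (\<Sum>k. of_nat (C k \<omega>)))" for x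
  define S' where "S' x = \<P>(\<omega> in M. ennreal x < (SUP k. of_nat (C k \<omega>)))" for x
  have le: "S' x \<le> S x" for x
    unfolding S_def S'_def
  proof (rule finite_measure_mono)
    have "(SUP k. of_nat (C k \<omega>) :: ennreal) \<le> (\<Sum>k. of_nat (C k \<omega>))" for \<omega>
    proof (rule SUP_least)
      fix k
      have "(of_nat (C k \<omega>) :: ennreal) = (\<Sum>k\<in>{k}. of_nat (C k \<omega>))" by simp
      also have "\<dots> \<le> (\<Sum>k. of_nat (C k \<omega>))" by (rule sum_le_suminf) auto
      finally show "(of_nat (C k \<omega>) :: ennreal) \<le> (\<Sum>k. of_nat (C k \<omega>))" .
    qed
    then show "{\<omega>\<in>space M. ennreal x < (SUP k. of_nat (C k \<omega>))} \<subseteq> {\<omega>\<in>space M. ennreal x < (\<Sum>k. of_nat (C k \<omega>))}"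
      by (auto intro: less_le_trans)
  qed auto
  have "\<P>(\<omega> in M. \<exists>k<n. x < real (C k \<omega>)) \<le> S' x" if "0 \<le> x" for n x
    unfolding S'_def
  proof (rule finite_measure_mono)
    show "{\<omega>\<in>space M. \<exists>k<n. x < real (C k \<omega>)} \<subseteq> {\<omega>\<in>space M. ennreal x < (SUP k. of_nat (C k \<omega>))}"
      using that by (auto simp: less_SUP_iff ennreal_of_nat_eq_real_of_nat ennreal_less_iff)
  qed auto
  then have "liminf_ge (\<lambda>x. S' x / tail a x) (\<Sum>k<n. tail_coeff m c k)" for n
    by (rule partial_max_liminf)
  then have lower: "liminf_ge (\<lambda>x. S' x / tail a x) (\<Sum>k. tail_coeff m c k)"
    by (intro liminf_ge_limit[OF summable_LIMSEQ[OF summable_coeff]]) auto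
  have upper: "limsup_le (\<lambda>x. S x / tail a x) (\<Sum>k. tail_coeff m c k)"
    using sum_tail_limsup by (simp add: S_def)
  have mono: "S' x / tail a x \<le> S x / tail a x" for x
    by (rule divide_right_mono[OF le less_imp_le[OF tail_pos]])
  have "liminf_ge (\<lambda>x. S x / tail a x) (\<Sum>k. tail_coeff m c k)"
    by (rule liminf_ge_mono[OF lower mono])
  moreover have "limsup_le (\<lambda>x. S' x / tail a x) (\<Sum>k. tail_coeff m c k)"
    by (rule limsup_le_mono[OF upper mono])
  ultimately show
    "((\<lambda>x. \<P>(\<omega> in M. ennreal x < (\<Sum>k. of_nat (C k \<omega>))) / tail a x) \<longlongrightarrow> (\<Sum>k. tail_coeff m c k)) at_top"
    "((\<lambda>x. \<P>(\<omega> in M. ennreal x < (SUP k. of_nat (C k \<omega>))) / tail a x) \<longlongrightarrow> (\<Sum>k. tail_coeff m c k)) at_top"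
    using lower upper by (simp_all add: tendsto_iff_limsup_liminf S_def S'_def)
qed

end

section \<open>Laws and independence of the clusters\<close>

text \<open>On a countable type the points of measure zero form a null set.\<close>

lemma pmf_of_discrete_law:
  fixes Z :: "'a \<Rightarrow> 'b::countable"
  assumes "prob_space M" "Z \<in> measurable M (count_space UNIV)"
  obtains p where "measure_pmf p = distr M (count_space UNIV) Z"
proof -
  interpret prob_space M by fact
  let ?D = "distr M (count_space UNIV) Z"
  interpret D: prob_space ?D using assms(2) by (rule prob_space_distr)
  have "AE x in ?D. measure ?D {x} \<noteq> 0"
  proof -
    have "AE x in ?D. \<forall>y. measure ?D {y} = 0 \<longrightarrow> x \<noteq> y"
      unfolding AE_all_countable
    proof (intro allI)
      fix y
      show "AE x in ?D. measure ?D {y} = 0 \<longrightarrow> x \<noteq> y"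
        by (rule AE_I[where N = "if measure ?D {y} = 0 then {y} else {}"])
           (auto simp: D.emeasure_eq_measure)
    qed
    then show ?thesis by eventually_elim auto
  qed
  then have "measure_pmf (Abs_pmf ?D) = ?D"
    by (intro Abs_pmf_inverse) (auto intro: D.prob_space_axioms)
  then show thesis by (rule that)
qed

context prob_space begin

text \<open>The probability \<open>P(S\<^sub>Z = y)\<close> is the sum of \<open>P(Z = n, S\<^sub>n = y)\<close> over \<open>n\<close>, and each term factorizes
  because \<open>Z\<close> is independent of \<open>S\<^sub>n\<close>.\<close>

lemma law_random_sum:
  fixes Z :: "'a \<Rightarrow> nat" and S :: "nat \<Rightarrow> 'a \<Rightarrow> nat"
  assumes [measurable]: "Z \<in> measurable M (count_space UNIV)" "\<And>n. S n \<in> measurable M (count_space UNIV)"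
    and Z: "distr M (count_space UNIV) Z = measure_pmf p"
    and S: "\<And>n. distr M (count_space UNIV) (S n) = measure_pmf (s n)"
    and ind: "\<And>n. indep_var (count_space UNIV) Z (count_space UNIV) (S n)"
  shows "distr M (count_space UNIV) (\<lambda>\<omega>. S (Z \<omega>) \<omega>) = measure_pmf (bind_pmf p s)"
proof (rule measure_eqI_countable[where A = UNIV])
  fix y :: nat
  have [measurable]: "(\<lambda>\<omega>. S (Z \<omega>) \<omega>) \<in> measurable M (count_space UNIV)"
    by (rule measurable_compose_countable[where f = S]) measurable
  have joint: "emeasure M {\<omega>\<in>space M. Z \<omega> = n \<and> S n \<omega> = y} = emeasure (measure_pmf (s n)) {y} * ennreal (pmf p n)" for n
  proof -
    have "prob ((\<lambda>x. (Z x, S n x)) -` ({n} \<times> {y}) \<inter> space M) = prob (Z -` {n} \<inter> space M) * prob (S n -` {y} \<inter> space M)"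
      by (rule indep_varD[OF ind]) auto
    moreover have "prob (Z -` {n} \<inter> space M) = pmf p n"
      using measure_distr[of Z M "count_space UNIV" "{n}"] by (simp add: Z measure_pmf_single)
    moreover have "prob (S n -` {y} \<inter> space M) = pmf (s n) y"
      using measure_distr[of "S n" M "count_space UNIV" "{y}"] by (simp add: S measure_pmf_single)
    moreover have "(\<lambda>x. (Z x, S n x)) -` ({n} \<times> {y}) \<inter> space M = {\<omega>\<in>space M. Z \<omega> = n \<and> S n \<omega> = y}" by auto
    ultimately show ?thesis
      by (simp add: emeasure_eq_measure emeasure_pmf_single mult.commute flip: ennreal_mult)
  qed
  have "emeasure (distr M (count_space UNIV) (\<lambda>\<omega>. S (Z \<omega>) \<omega>)) {y} = emeasure M (\<Union>n. {\<omega>\<in>space M. Z \<omega> = n \<and> S n \<omega> = y})"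
    by (subst emeasure_distr) (auto intro!: arg_cong[where f = "emeasure M"])
  also have "\<dots> = (\<Sum>n. emeasure M {\<omega>\<in>space M. Z \<omega> = n \<and> S n \<omega> = y})"
    by (rule suminf_emeasure[symmetric]) (auto simp: disjoint_family_on_def)
  also have "\<dots> = (\<integral>\<^sup>+n. emeasure (measure_pmf (s n)) {y} \<partial>measure_pmf p)"
    by (simp add: joint nn_integral_measure_pmf nn_integral_count_space_nat mult.commute)
  also have "\<dots> = emeasure (measure_pmf (bind_pmf p s)) {y}" by simp
  finally show "emeasure (distr M (count_space UNIV) (\<lambda>\<omega>. S (Z \<omega>) \<omega>)) {y} = emeasure (measure_pmf (bind_pmf p s)) {y}" .
qed auto

text \<open>Functions of disjoint groups of independent variables are independent. The functions are taken on whole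
  families, and the locality assumptions say that they only read their own coordinates.\<close>

lemma indep_var_of_coordinates:
  assumes X: "indep_vars M' X I" and sub: "J \<subseteq> I" "K \<subseteq> I" "J \<inter> K = {}"
    and f: "f \<in> measurable (PiM J M') N1" "g \<in> measurable (PiM K M') N2"
    and loc: "\<And>h. f (restrict h J) = f h" "\<And>h. g (restrict h K) = g h"
  shows "indep_var N1 (\<lambda>\<omega>. f (\<lambda>i. X i \<omega>)) N2 (\<lambda>\<omega>. g (\<lambda>i. X i \<omega>))"
  using indep_var_compose[OF indep_var_restrict[OF X sub(3,1,2)] f]
  by (simp add: comp_def loc)

end

lemma measurable_sum_count_space:
  fixes f :: "'i \<Rightarrow> 'a \<Rightarrow> nat"
  assumes "\<And>i. i \<in> I \<Longrightarrow> f i \<in> measurable M (count_space UNIV)"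
  shows "(\<lambda>x. \<Sum>i\<in>I. f i x) \<in> measurable M (count_space UNIV)"
  using assms
proof (induction I rule: infinite_finite_induct)
  case (insert j I)
  have [measurable]: "f j \<in> measurable M (count_space UNIV)" "(\<lambda>x. \<Sum>i\<in>I. f i x) \<in> measurable M (count_space UNIV)"
    using insert by auto
  have "(\<lambda>x. f j x + (\<Sum>i\<in>I. f i x)) \<in> measurable M (count_space UNIV)" by measurable
  then show ?case using insert(1,2) by simp
qed auto

lemma (in prob_space) law_iid_sum:
  fixes X :: "'i \<Rightarrow> 'a \<Rightarrow> nat" and \<iota> :: "nat \<Rightarrow> 'i"
  assumes X: "indep_vars (\<lambda>_. count_space UNIV) X UNIV" and inj: "inj \<iota>"
    and law: "\<And>i. distr M (count_space UNIV) (X (\<iota> i)) = measure_pmf p"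
  shows "distr M (count_space UNIV) (\<lambda>\<omega>. \<Sum>i<n. X (\<iota> i) \<omega>) = measure_pmf (iid_sum p n)"
proof (induction n)
  have [measurable]: "X i \<in> measurable M (count_space UNIV)" for i
    using X by (simp add: indep_vars_def)
  have [measurable]: "(\<lambda>\<omega>. \<Sum>i<n. X (\<iota> i) \<omega>) \<in> measurable M (count_space UNIV)" for n
    by (rule measurable_sum_count_space) simp
  {
    case 0
    have "distr M (count_space UNIV) (\<lambda>\<omega>. 0 :: nat) = measure_pmf (return_pmf 0)"
    proof (rule measure_eqI_countable[where A = UNIV])
      fix y :: nat
      show "emeasure (distr M (count_space UNIV) (\<lambda>\<omega>. 0)) {y} = emeasure (measure_pmf (return_pmf 0)) {y}"
        by (subst emeasure_distr) (auto simp: emeasure_space_1 indicator_def)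
    qed auto
    then show ?case by simp
  next
    case (Suc n)
    have iv: "indep_var (count_space UNIV) (\<lambda>\<omega>. \<Sum>i<n. X (\<iota> i) \<omega>) (count_space UNIV) (X (\<iota> n))"
      by (rule indep_var_of_coordinates[OF X, of "\<iota> ` {..<n}" "{\<iota> n}" "\<lambda>h. \<Sum>i<n. h (\<iota> i)" "count_space UNIV" "\<lambda>h. h (\<iota> n)"])
         (use inj in \<open>auto intro!: measurable_sum_count_space measurable_component_singleton dest: injD\<close>)
    have shift: "distr M (count_space UNIV) (\<lambda>\<omega>. k + X (\<iota> n) \<omega>) = measure_pmf (map_pmf ((+) k) p)" for k
    proof -
      have "distr M (count_space UNIV) (\<lambda>\<omega>. k + X (\<iota> n) \<omega>) = distr (distr M (count_space UNIV) (X (\<iota> n))) (count_space UNIV) ((+) k)"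
        by (subst distr_distr) (auto simp: comp_def)
      then show ?thesis by (simp add: law map_pmf_rep_eq)
    qed
    have "distr M (count_space UNIV) (\<lambda>\<omega>. (\<Sum>i<n. X (\<iota> i) \<omega>) + X (\<iota> n) \<omega>)
        = measure_pmf (bind_pmf (iid_sum p n) (\<lambda>k. map_pmf ((+) k) p))"
    proof (rule law_random_sum[where S = "\<lambda>k \<omega>. k + X (\<iota> n) \<omega>", OF _ _ Suc shift])
      show "indep_var (count_space UNIV) (\<lambda>\<omega>. \<Sum>i<n. X (\<iota> i) \<omega>) (count_space UNIV) (\<lambda>\<omega>. k + X (\<iota> n) \<omega>)" for k
        using indep_var_compose[OF iv, of id "count_space UNIV" "(+) k" "count_space UNIV"]
        by (simp add: comp_def)
    qed auto
    also have "bind_pmf (iid_sum p n) (\<lambda>k. map_pmf ((+) k) p) = iid_sum p (Suc n)"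
      by (simp add: pair_pmf_def map_pmf_def bind_assoc_pmf bind_return_pmf)
    finally show ?case by simp
  }
qed

text \<open>The cluster with superscript \<open>s\<close> as a function of one family \<open>h\<close> that lists all immigration and offspring
  variables. This makes visible which coordinates a cluster reads, and hence which clusters are independent.\<close>

primrec cluster_of :: "int \<Rightarrow> nat \<Rightarrow> (int + int \<times> int \<times> nat \<Rightarrow> nat) \<Rightarrow> nat" where
  "cluster_of s 0 h = h (Inl s)"
| "cluster_of s (Suc k) h = (\<Sum>i<cluster_of s k h. h (Inr (s, s + int (Suc k), i)))"

definition cluster_coords :: "int \<Rightarrow> nat \<Rightarrow> (int + int \<times> int \<times> nat) set" where
  "cluster_coords s k = insert (Inl s) {Inr (s, u, i) |u i. u \<le> s + int k}"

lemma cluster_coords_mono: "j \<le> k \<Longrightarrow> cluster_coords s j \<subseteq> cluster_coords s k"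
  by (auto simp: cluster_coords_def)

lemma cluster_of_measurable:
  "cluster_coords s k \<subseteq> J \<Longrightarrow> cluster_of s k \<in> measurable (PiM J (\<lambda>_. count_space UNIV)) (count_space UNIV)"
proof (induction k)
  case 0
  then show ?case by (simp add: cluster_coords_def measurable_component_singleton)
next
  case (Suc k)
  have "(\<lambda>h. \<Sum>i<n. h (Inr (s, s + int (Suc k), i)) :: nat) \<in> measurable (PiM J (\<lambda>_. count_space UNIV)) (count_space UNIV)" for n
    using Suc.prems by (intro measurable_sum_count_space measurable_component_singleton) (auto simp: cluster_coords_def)
  moreover have "cluster_of s k \<in> measurable (PiM J (\<lambda>_. count_space UNIV)) (count_space UNIV)"
    using Suc.prems cluster_coords_mono[of k "Suc k" s] by (intro Suc.IH) auto
  ultimately show ?case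
    unfolding cluster_of.simps by (rule measurable_compose_countable)
qed

lemma cluster_of_restrict: "cluster_coords s k \<subseteq> J \<Longrightarrow> cluster_of s k (restrict h J) = cluster_of s k h"
proof (induction k)
  case (Suc k)
  have "cluster_of s k (restrict h J) = cluster_of s k h"
    using Suc.prems cluster_coords_mono[of k "Suc k" s] by (intro Suc.IH) auto
  moreover have "Inr (s, s + int (Suc k), i) \<in> J" for i
    using Suc.prems by (auto simp: cluster_coords_def)
  ultimately show ?case by (simp only: cluster_of.simps restrict_apply' cong: sum.cong)
qed (auto simp: cluster_coords_def)

lemma cluster_eq_cluster_of:
  "cluster Bs As t k \<omega> = cluster_of (t - int k) k (\<lambda>j. case_sum Bs (\<lambda>(s, u, i). As s u i) j \<omega>)"
proof -
  have "iterate_mappings (\<lambda>u. random_mapping (As s u) \<omega>) s j (Bs s \<omega>) =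
      cluster_of s j (\<lambda>j. case_sum Bs (\<lambda>(s, u, i). As s u i) j \<omega>)" for s j
    by (induction j) (simp_all add: random_mapping_def)
  then show ?thesis by (simp add: cluster_def)
qed

context prob_space begin

text \<open>The variables of step \<open>k + 1\<close> have subscript \<open>s + k + 1\<close>, which does not occur among the coordinates of
  the first \<open>k\<close> steps.\<close>

lemma cluster_law:
  assumes X: "indep_vars (\<lambda>_. count_space UNIV) X (UNIV :: (int + int \<times> int \<times> nat) set)"
    and B: "distr M (count_space UNIV) (X (Inl s)) = measure_pmf b"
    and A: "\<And>u i. distr M (count_space UNIV) (X (Inr (s, u, i))) = measure_pmf a"
  shows "distr M (count_space UNIV) (\<lambda>\<omega>. cluster_of s k (\<lambda>j. X j \<omega>)) = measure_pmf (generation a b k)"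
proof (induction k)
  case 0
  then show ?case by (simp add: B)
next
  case (Suc k)
  let ?Y = "\<lambda>i. X (Inr (s, s + int (Suc k), i))"
  have Xm: "X j \<in> measurable M (count_space UNIV)" for j
    using X by (simp add: indep_vars_def)
  let ?J = "cluster_coords s k" and ?K = "range (\<lambda>i. Inr (s, s + int (Suc k), i))"
  have iv: "indep_var (count_space UNIV) (\<lambda>\<omega>. cluster_of s k (\<lambda>j. X j \<omega>))
      (count_space UNIV) (\<lambda>\<omega>. \<Sum>i<n. ?Y i \<omega>)" for n
    by (rule indep_var_of_coordinates[OF X, of ?J ?K "cluster_of s k" "count_space UNIV"
          "\<lambda>h. \<Sum>i<n. h (Inr (s, s + int (Suc k), i))"])
       (auto intro!: cluster_of_measurable measurable_sum_count_space measurable_component_singleton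
             simp: cluster_of_restrict, auto simp: cluster_coords_def)
  have S: "distr M (count_space UNIV) (\<lambda>\<omega>. \<Sum>i<n. ?Y i \<omega>) = measure_pmf (iid_sum a n)" for n
    by (rule law_iid_sum[OF X]) (auto simp: A inj_def)
  have "distr M (count_space UNIV) (\<lambda>\<omega>. \<Sum>i<cluster_of s k (\<lambda>j. X j \<omega>). ?Y i \<omega>)
      = measure_pmf (bind_pmf (generation a b k) (iid_sum a))"
  proof (rule law_random_sum[where S = "\<lambda>n \<omega>. \<Sum>i<n. ?Y i \<omega>", OF _ _ Suc S iv])
    show "(\<lambda>\<omega>. cluster_of s k (\<lambda>j. X j \<omega>)) \<in> measurable M (count_space UNIV)"
      using iv[of 0] by (rule indep_var_rv1)
    show "(\<lambda>\<omega>. \<Sum>i<n. ?Y i \<omega>) \<in> measurable M (count_space UNIV)" for n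
      by (intro measurable_sum_count_space Xm)
  qed
  then show ?case by (simp add: compound_def)
qed

text \<open>Clusters with different \<open>k\<close> carry different superscripts \<open>t - k\<close>, so they read disjoint coordinates.\<close>

lemma clusters_indep:
  assumes X: "indep_vars (\<lambda>_. count_space UNIV) X (UNIV :: (int + int \<times> int \<times> nat) set)"
  shows "indep_vars (\<lambda>_. count_space UNIV) (\<lambda>k \<omega>. cluster_of (t - int k) k (\<lambda>j. X j \<omega>)) UNIV"
proof -
  let ?K = "\<lambda>k. cluster_coords (t - int k) k"
  have "indep_vars (\<lambda>k. PiM (?K k) (\<lambda>_. count_space UNIV)) (\<lambda>k \<omega>. restrict (\<lambda>i. X i \<omega>) (?K k)) UNIV"
    by (rule indep_vars_restrict[OF X]) (auto simp: disjoint_family_on_def cluster_coords_def)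
  from indep_vars_compose2[OF this, of "\<lambda>k. cluster_of (t - int k) k" "\<lambda>_. count_space UNIV"]
  show ?thesis by (simp add: cluster_of_measurable cluster_of_restrict)
qed

end

section \<open>The tail of the stationary distribution\<close>

context heavy_tailed_offspring begin

text \<open>Separating the last term \<open>\<mu> powr (k \<alpha>) * \<mu> powr (k (1 - \<alpha>)) = \<mu> ^ k\<close> of the sum gives
  \<open>d\<^sub>k\<^sub>+\<^sub>1 = \<mu>\<^sup>k + \<mu>\<^sup>\<alpha> d\<^sub>k\<close>.\<close>

lemma tail_coeff_eq_psi_coeff: "tail_coeff m c k = psi_coeff m c \<mu> \<alpha> k"
proof (induction k)
  case 0
  show ?case using mean_pos by (simp add: psi_coeff_def d_coeff_def)
next
  case (Suc k)
  have mult: "\<mu> powr r * \<mu> powr s = \<mu> powr (r + s)" for r s using mean_pos by (simp add: powr_add)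
  have "d_coeff \<mu> \<alpha> (Suc k) = \<mu> powr (real k * \<alpha>) * (\<Sum>j<k. \<mu> powr (real j * (1 - \<alpha>)))
      + \<mu> powr (real k * \<alpha>) * \<mu> powr (real k * (1 - \<alpha>))"
    by (simp add: d_coeff_def distrib_left)
  also have "\<mu> powr (real k * \<alpha>) * \<mu> powr (real k * (1 - \<alpha>)) = \<mu> ^ k"
    using mean_pos by (simp add: mult algebra_simps powr_realpow)
  also have "\<mu> powr (real k * \<alpha>) = \<mu> powr ((real k - 1) * \<alpha>) * \<mu> powr \<alpha>"
    by (simp add: mult algebra_simps)
  finally have d: "d_coeff \<mu> \<alpha> (Suc k) = \<mu> ^ k + d_coeff \<mu> \<alpha> k * \<mu> powr \<alpha>"
    by (simp add: d_coeff_def mult_ac)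
  have "\<mu> powr (real (Suc k) * \<alpha>) = \<mu> powr (real k * \<alpha>) * \<mu> powr \<alpha>"
    by (simp add: mult algebra_simps)
  then show ?case using Suc by (simp add: psi_coeff_def d algebra_simps)
qed

end

lemma tail_eq_prob:
  assumes "Z \<in> measurable M (count_space UNIV)" "measure_pmf p = distr M (count_space UNIV) Z"
  shows "tail p x = \<P>(\<omega> in M. real (Z \<omega>) > x)"
  using assms by (simp add: tail_def measure_distr vimage_def Int_def conj_commute)

lemma nn_mean_eq:
  assumes "Z \<in> measurable M (count_space UNIV)" "measure_pmf p = distr M (count_space UNIV) Z"
  shows "(\<integral>\<^sup>+n. ennreal (real n) \<partial>measure_pmf p) = (\<integral>\<^sup>+\<omega>. ennreal (real (Z \<omega>)) \<partial>M)"
  using assms by (simp add: nn_integral_distr)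

text \<open>Integrability of the offspring variable comes from \<open>\<mu> > 0\<close>, because the Bochner integral of a
  nonintegrable function is 0. Positivity of \<open>L\<close> is known only for large arguments, but the tail is monotone.\<close>

lemma regularly_varying_offspring:
  assumes "Z \<in> measurable M (count_space UNIV)" "measure_pmf p = distr M (count_space UNIV) Z"
    and \<mu>: "\<mu> = (\<integral>\<omega>. real (Z \<omega>) \<partial>M)" "0 < \<mu>" and \<alpha>: "1 < \<alpha>" "\<alpha> < 2" and L: "slowly_varying L"
    and tail: "\<And>x::real. x > 0 \<Longrightarrow> \<P>(\<omega> in M. real (Z \<omega>) > x) = x powr (-\<alpha>) * L x"
  shows "heavy_tailed_offspring p \<mu> \<alpha>"
proof
  have tail': "tail p x = x powr (-\<alpha>) * L x" if "0 < x" for x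
    using tail[OF that] tail_eq_prob[OF assms(1,2)] by simp
  obtain x0 where x0: "0 < x0" "\<And>x. x0 \<le> x \<Longrightarrow> 0 < L x"
    using L by (auto simp: slowly_varying_def)
  have "integrable M (\<lambda>\<omega>. real (Z \<omega>))"
    using \<mu> not_integrable_integral_eq by fastforce
  then show "(\<integral>\<^sup>+n. ennreal (real n) \<partial>measure_pmf p) = ennreal \<mu>"
    unfolding nn_mean_eq[OF assms(1,2)] \<mu>(1) by (intro nn_integral_eq_integral) auto
  show "0 < tail p x" for x
  proof -
    have "0 < tail p (max x x0)" using x0 by (simp add: tail' less_max_iff_disj)
    also have "\<dots> \<le> tail p x" by (rule tail_antimono) simp
    finally show ?thesis .
  qed
  show "((\<lambda>x. tail p (l * x) / tail p x) \<longlongrightarrow> l powr (-\<alpha>)) at_top" if l: "0 < l" for l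
  proof (rule Lim_transform_eventually)
    have "((\<lambda>x. L (l * x) / L x) \<longlongrightarrow> 1) at_top" using L l by (auto simp: slowly_varying_def)
    from tendsto_mult[OF tendsto_const this, of "l powr (-\<alpha>)"]
    show "((\<lambda>x. l powr (-\<alpha>) * (L (l * x) / L x)) \<longlongrightarrow> l powr (-\<alpha>)) at_top" by simp
    show "eventually (\<lambda>x. l powr (-\<alpha>) * (L (l * x) / L x) = tail p (l * x) / tail p x) at_top"
      using eventually_gt_at_top[of 0]
      by eventually_elim (use l in \<open>simp add: tail' powr_mult\<close>)
  qed
qed (use \<mu> \<alpha> in auto)

text \<open>The stationary law is reached through the independent generations \<open>C\<^sub>k\<close>. The hypothesis on
  \<open>X\<close> and \<open>X'\<close> concerns their laws only, so the tail probabilities are first transported to the space of the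
  clusters.\<close>

theorem theorem2p4:
  fixes P :: "'p measure" and A B :: "'p \<Rightarrow> nat"
    and M :: "'m measure"
    and Bs :: "int \<Rightarrow> 'm \<Rightarrow> nat"
    and As :: "int \<Rightarrow> int \<Rightarrow> nat \<Rightarrow> 'm \<Rightarrow> nat"
    and N :: "'n measure" and X X' :: "'n \<Rightarrow> ennreal"
    and \<mu> \<alpha> c :: real and L :: "real \<Rightarrow> real" and t :: int
  assumes "prob_space P" and "prob_space M" and "prob_space N"
    and "A \<in> measurable P (count_space UNIV)" and "B \<in> measurable P (count_space UNIV)"
    and "\<mu> = (\<integral>\<omega>. real (A \<omega>) \<partial>P)" and "0 < \<mu>" and "\<mu> < 1"
    and "1 < \<alpha>" and "\<alpha> < 2"
    and "slowly_varying L"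
    and "\<And>x::real. x > 0 \<Longrightarrow> \<P>(\<omega> in P. real (A \<omega>) > x) = x powr (-\<alpha>) * L x"
    and "c \<ge> 0"
    and "((\<lambda>x::real. \<P>(\<omega> in P. real (B \<omega>) > x) / \<P>(\<omega> in P. real (A \<omega>) > x)) \<longlongrightarrow> c) at_top"
    and "c > 0 \<Longrightarrow> consistently_varying P (\<lambda>\<omega>. real (B \<omega>))"
    and "prob_space.indep_vars M (\<lambda>_. count_space UNIV)
           (case_sum Bs (\<lambda>(s, u, i). As s u i)) (UNIV :: (int + int \<times> int \<times> nat) set)"
    and "\<And>s. distr M (count_space UNIV) (Bs s) = distr P (count_space UNIV) B"
    and "\<And>s u i. distr M (count_space UNIV) (As s u i) = distr P (count_space UNIV) A"
    and "X \<in> borel_measurable N" and "X' \<in> borel_measurable N"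
    and "distr N borel X = distr M borel (\<lambda>\<omega>. \<Sum>k. of_nat (cluster Bs As t k \<omega>) :: ennreal)"
    and "distr N borel X' = distr M borel (\<lambda>\<omega>. SUP k. of_nat (cluster Bs As t k \<omega>) :: ennreal)"
  defines "\<psi> \<equiv> psi_coeff (\<integral>\<omega>. real (B \<omega>) \<partial>P) c \<mu> \<alpha>"
  shows "summable \<psi> \<and>
    ((\<lambda>x::real. \<P>(\<omega> in N. X \<omega> > ennreal x) / \<P>(\<omega> in P. real (A \<omega>) > x))
       \<longlongrightarrow> (\<Sum>k. \<psi> k)) at_top \<and>
    ((\<lambda>x::real. \<P>(\<omega> in N. X' \<omega> > ennreal x) / \<P>(\<omega> in P. real (A \<omega>) > x))
       \<longlongrightarrow> (\<Sum>k. \<psi> k)) at_top"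
proof -
  note A = assms(4) and B = assms(5)
  interpret P: prob_space P by fact
  interpret M: prob_space M by fact
  obtain a where a: "measure_pmf a = distr P (count_space UNIV) A"
    by (rule pmf_of_discrete_law[OF assms(1) A])
  obtain b where b: "measure_pmf b = distr P (count_space UNIV) B"
    by (rule pmf_of_discrete_law[OF assms(1) B])
  interpret heavy_tailed_offspring a \<mu> \<alpha>
    by (rule regularly_varying_offspring[OF A a assms(6,7,9,10,11,12)])
  have tail_b: "((\<lambda>x. tail b x / tail a x) \<longlongrightarrow> c) at_top"
    unfolding tail_eq_prob[OF A a] tail_eq_prob[OF B b] by fact
  define m where "m = (\<integral>\<omega>. real (B \<omega>) \<partial>P)"
  have m: "(\<integral>\<^sup>+n. ennreal (real n) \<partial>measure_pmf b) = ennreal m"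
  proof -
    have "(\<integral>\<^sup>+\<omega>. ennreal (real (B \<omega>)) \<partial>P) < \<infinity>"
      using dominated_finite_mean[OF dominated_if_tendsto[OF tail_b]] by (simp only: nn_mean_eq[OF B b])
    then have "integrable P (\<lambda>\<omega>. real (B \<omega>))"
      using B by (intro integrableI_nonneg) auto
    then show ?thesis
      unfolding nn_mean_eq[OF B b] m_def by (intro nn_integral_eq_integral) auto
  qed
  let ?X = "case_sum Bs (\<lambda>(s, u, i). As s u i)"
  interpret independent_generations a \<mu> \<alpha> M b m c "cluster Bs As t"
  proof
    show "M.indep_vars (\<lambda>_. count_space UNIV) (cluster Bs As t) UNIV"
      using M.clusters_indep[OF assms(16), of t] unfolding cluster_eq_cluster_of[symmetric] by simp
    show "distr M (count_space UNIV) (cluster Bs As t k) = measure_pmf (generation a b k)" for k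
      using M.cluster_law[OF assms(16), of "t - int k" b a k]
      unfolding cluster_eq_cluster_of[symmetric] by (simp add: assms(17,18) a b)
  qed (use m tail_b assms(8,13) in \<open>auto simp: m_def\<close>)
  have \<psi>: "tail_coeff m c = \<psi>"
    unfolding \<psi>_def m_def[symmetric] by (rule ext) (rule tail_coeff_eq_psi_coeff)
  have law_tail: "\<P>(\<omega> in N. Y \<omega> > ennreal x) = \<P>(\<omega> in M. ennreal x < Y' \<omega>)"
    if "Y \<in> borel_measurable N" "Y' \<in> borel_measurable M" "distr N borel Y = distr M borel Y'"
    for Y :: "'n \<Rightarrow> ennreal" and Y' and x :: real
  proof -
    have "measure (distr N borel Y) {ennreal x<..} = measure (distr M borel Y') {ennreal x<..}"
      using that(3) by simp
    then show ?thesis using that(1,2) by (simp add: measure_distr vimage_def Int_def conj_commute)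
  qed
  have X: "\<P>(\<omega> in N. X \<omega> > ennreal x) = \<P>(\<omega> in M. ennreal x < (\<Sum>k. of_nat (cluster Bs As t k \<omega>)))" for x
    by (rule law_tail[OF assms(19) _ assms(21)]) measurable
  have X': "\<P>(\<omega> in N. X' \<omega> > ennreal x) = \<P>(\<omega> in M. ennreal x < (SUP k. of_nat (cluster Bs As t k \<omega>)))" for x
    by (rule law_tail[OF assms(20) _ assms(22)]) measurable
  show ?thesis
    using summable_coeff sum_and_sup_tail unfolding X X' \<psi> tail_eq_prob[OF A a] by blast
qed

end
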